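(* Let $\nu\ge1$ and let $J$ be the Jacobi matrix on $\ell^2(\mathbb{Z}^\nu)$ given by $$(Ju)(n)=\sum_{|m-n|=1}a_{(n,m)}u(m)+b_nu(n),$$ where the real numbers $b_n$ are indexed by $n\in\mathbb{Z}^\nu$ and the real numbers $a_{(n,m)}$ by bonds, i.e. unordered pairs $\{m,n\}$ with $|m-n|=1$. Suppose $$\sup_{|m-n|=1}\bigl(|a_{(n,m)}|+|a_{(n,m)}|^{-1}\bigr)+\sup_n|b_n|<\infty .$$ Let $\mathcal{L}$ denote the set of limit points $\tilde J$ of $J$ at infinity. Then $$\sigma_{\mathrm{ess}}(J)=\overline{\bigcup_{\tilde J\in\mathcal{L}}\sigma(\tilde J)}.$$
   Context: A Jacobi matrix $\tilde J$ on $\ell^2(\mathbb{Z}^\nu)$ of the same form, with parameters $\tilde a_{(k,\ell)},\tilde b_\ell$, is a limit point of $J$ at infinity if and only if there are points $n_j\in\mathbb{Z}^\nu$ with $|n_j|\to\infty$ such that for all $\ell\in\mathbb{Z}^\nu$ and all bonds $(k,\ell)$ one has $b_{n_j+\ell}\to\tilde b_\ell$ and $a_{(n_j+\ell,\,n_j+k)}\to\tilde a_{(k,\ell)}$ as $j\to\infty$. $\sigma,\sigma_{\mathrm{ess}}$ denote spectrum and essential spectrum. *)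

theory Defs
  imports "HOL-Analysis.Analysis" "HOL-Library.Function_Algebras"
begin

text \<open>Complex-valued functions form a complex vector space under the pointwise operations
  of \<^theory>\<open>HOL-Library.Function_Algebras\<close>.\<close>

definition cscale :: "complex \<Rightarrow> ('a \<Rightarrow> complex) \<Rightarrow> 'a \<Rightarrow> complex" where
  "cscale c u = (\<lambda>n. c * u n)"

interpretation cfun: vector_space "cscale :: complex \<Rightarrow> ('a \<Rightarrow> complex) \<Rightarrow> 'a \<Rightarrow> complex"
  by unfold_locales (auto simp: cscale_def fun_eq_iff algebra_simps)

definition ell2 :: "('a \<Rightarrow> complex) set" where
  "ell2 = {u. (\<lambda>n. (cmod (u n))\<^sup>2) summable_on UNIV}"

definition ell2_norm :: "('a \<Rightarrow> complex) \<Rightarrow> real" where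
  "ell2_norm u = sqrt (\<Sum>\<^sub>\<infinity>n. (cmod (u n))\<^sup>2)"

text \<open>Operators on \<^const>\<open>ell2\<close> are represented by maps on all functions; only their values on
  \<^const>\<open>ell2\<close> enter the notions below.\<close>

definition bounded_ell2_operator :: "(('a \<Rightarrow> complex) \<Rightarrow> 'a \<Rightarrow> complex) \<Rightarrow> bool" where
  "bounded_ell2_operator A \<longleftrightarrow>
     (\<forall>u\<in>ell2. A u \<in> ell2) \<and>
     (\<forall>u\<in>ell2. \<forall>v\<in>ell2. A (u + v) = A u + A v) \<and>
     (\<forall>c. \<forall>u\<in>ell2. A (cscale c u) = cscale c (A u)) \<and>
     (\<exists>C. \<forall>u\<in>ell2. ell2_norm (A u) \<le> C * ell2_norm u)"

definition ell2_resolvent_set :: "(('a \<Rightarrow> complex) \<Rightarrow> 'a \<Rightarrow> complex) \<Rightarrow> complex set" where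
  "ell2_resolvent_set A =
     {z. \<exists>R. bounded_ell2_operator R \<and>
             (\<forall>u\<in>ell2. R (A u - cscale z u) = u \<and> A (R u) - cscale z (R u) = u)}"

definition ell2_spectrum :: "(('a \<Rightarrow> complex) \<Rightarrow> 'a \<Rightarrow> complex) \<Rightarrow> complex set" where
  "ell2_spectrum A = - ell2_resolvent_set A"

definition ell2_eigenspace ::
    "(('a \<Rightarrow> complex) \<Rightarrow> 'a \<Rightarrow> complex) \<Rightarrow> complex \<Rightarrow> ('a \<Rightarrow> complex) set" where
  "ell2_eigenspace A z = {u \<in> ell2. A u = cscale z u}"

text \<open>The discrete spectrum of a self-adjoint operator consists of the isolated points of the
  spectrum that are eigenvalues of finite multiplicity, and the essential spectrum is its
  complement in the spectrum. The geometric multiplicity is used, which for self-adjoint operators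
  (the only ones considered here) agrees with the algebraic one.\<close>

definition ell2_discrete_spectrum :: "(('a \<Rightarrow> complex) \<Rightarrow> 'a \<Rightarrow> complex) \<Rightarrow> complex set" where
  "ell2_discrete_spectrum A =
     {z. z isolated_in ell2_spectrum A \<and> ell2_eigenspace A z \<noteq> {0} \<and>
         (\<exists>B. finite B \<and> ell2_eigenspace A z \<subseteq> cfun.span B)}"

definition ell2_essential_spectrum :: "(('a \<Rightarrow> complex) \<Rightarrow> 'a \<Rightarrow> complex) \<Rightarrow> complex set" where
  "ell2_essential_spectrum A = ell2_spectrum A - ell2_discrete_spectrum A"

text \<open>Points of the lattice are integer vectors, measured by their Euclidean norm.\<close>

definition lattice_norm :: "int ^ 'n \<Rightarrow> real" where
  "lattice_norm n = norm (\<chi> i. real_of_int (n $ i))"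

definition is_bond :: "int ^ 'n \<Rightarrow> int ^ 'n \<Rightarrow> bool" where
  "is_bond m n \<longleftrightarrow> lattice_norm (m - n) = 1"

text \<open>The sum in the Jacobi matrix below ranges over a finite set.\<close>

lemma finite_bonds: "finite {m :: int ^ 'n. is_bond m n}"
proof -
  have "vec_nth ` {m. is_bond m n} \<subseteq> PiE UNIV (\<lambda>i. {n $ i - 1..n $ i + 1})"
  proof (intro image_subsetI PiE_I)
    fix m :: "int ^ 'n" and i assume "m \<in> {m. is_bond m n}"
    then have "\<bar>real_of_int (m $ i - n $ i)\<bar> \<le> 1"
      using component_le_norm_cart[of "\<chi> i. real_of_int ((m - n) $ i)" i]
      by (simp add: is_bond_def lattice_norm_def)
    then have "\<bar>m $ i - n $ i\<bar> \<le> 1"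
      by linarith
    then show "m $ i \<in> {n $ i - 1..n $ i + 1}"
      by (auto simp: abs_le_iff)
  qed auto
  then have "finite (vec_nth ` {m. is_bond m n})"
    by (rule finite_subset) (simp add: finite_PiE)
  then show ?thesis
    by (rule finite_imageD) (simp add: inj_on_def vec_nth_inject)
qed

text \<open>Off-diagonal coefficients are indexed by unordered pairs, encoded as two-element sets;
  the values of \<open>a\<close> on sets that are not bonds are irrelevant throughout.\<close>

definition jacobi ::
    "((int ^ 'n) set \<Rightarrow> real) \<Rightarrow> (int ^ 'n \<Rightarrow> real) \<Rightarrow> (int ^ 'n \<Rightarrow> complex) \<Rightarrow> int ^ 'n \<Rightarrow> complex"
  where
  "jacobi a b u n =
     (\<Sum>m | is_bond m n. complex_of_real (a {n, m}) * u m) + complex_of_real (b n) * u n"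

definition limit_points_at_infinity ::
    "((int ^ 'n) set \<Rightarrow> real) \<Rightarrow> (int ^ 'n \<Rightarrow> real) \<Rightarrow>
     ((int ^ 'n \<Rightarrow> complex) \<Rightarrow> int ^ 'n \<Rightarrow> complex) set" where
  "limit_points_at_infinity a b =
     {jacobi a' b' | a' b'. \<exists>x :: nat \<Rightarrow> int ^ 'n.
        filterlim (\<lambda>j. lattice_norm (x j)) at_top sequentially \<and>
        (\<forall>l. (\<lambda>j. b (x j + l)) \<longlonglongrightarrow> b' l) \<and>
        (\<forall>k l. is_bond k l \<longrightarrow> (\<lambda>j. a {x j + l, x j + k}) \<longlonglongrightarrow> a' {k, l})}"

end

theory Submission
  imports Defs
begin

text \<open>The essential spectrum is characterized by approximate eigenvectors that live far out: \<open>x\<close>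
  belongs to it iff for every \<open>e > 0\<close> and every finite set \<open>F\<close> of sites some \<open>v\<close> vanishing on \<open>F\<close>
  satisfies \<open>\<parallel>(J - x) v\<parallel> < e \<parallel>v\<parallel>\<close>. An approximate eigenvector of a limit point of \<open>J\<close> can be cut
  off to finite support and translated far out, which gives one inclusion. Conversely, averaging over all
  translates of a large box shows that a far approximate eigenvector of \<open>J\<close> can be restricted to one of
  these translates at a cost that only depends on the size of the box. Translating back to the
  origin, compactness yields a limit point \<open>J'\<close> and a vector \<open>w\<close> with \<open>\<parallel>(J' - x) w\<parallel> < e \<parallel>w\<parallel>\<close>,
  so that \<open>J'\<close> has spectrum within \<open>e\<close> of \<open>x\<close>. The spectral theorem is avoided: all that
  is needed are the contraction principle and Cauchy-Schwarz estimates.\<close>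

section \<open>Self-adjoint operators on real Hilbert spaces\<close>

text \<open>Coefficients converge only site by site along a subsequence, and a bounded sequence of
  vectors may converge coordinatewise to 0. Both difficulties disappear when all vectors live on one
  fixed finite set: the norms of \<open>v\<close> and of \<open>(J - x) v\<close> are then finite
  sums that pass to the limit, and the limit vector keeps norm 1. Hence the box has to be fixed by
  the tolerance before the distance to the origin is chosen. The limit point found depends on the
  tolerance too, so \<open>x\<close> is only approximated by spectra of limit points; this is the
  origin of the closure.

  The essential spectrum is defined by removing isolated eigenvalues of finite multiplicity, which
  is usually related to approximate eigenvectors through spectral projections. Two facts replace
  them. A self-adjoint operator that is bounded below is bijective, so that a real number is tested
  for membership in the spectrum by a single inequality. At an isolated point of the spectrum, every
  vector with small residual lies near the kernel.\<close>

definition bounded_below :: "('a::real_normed_vector \<Rightarrow> 'b::real_normed_vector) \<Rightarrow> bool" where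
  "bounded_below f \<longleftrightarrow> (\<exists>c>0. \<forall>u. c * norm u \<le> norm (f u))"

definition self_adjoint :: "('a::real_inner \<Rightarrow> 'a) \<Rightarrow> bool" where
  "self_adjoint A \<longleftrightarrow> bounded_linear A \<and> (\<forall>u v. A u \<bullet> v = u \<bullet> A v)"

lemma bounded_belowE:
  assumes "bounded_below f"
  obtains c where "c > 0" "\<And>u. c * norm u \<le> norm (f u)"
  using assms unfolding bounded_below_def by blast

lemma not_bounded_belowE:
  assumes "\<not> bounded_below f" "c > 0"
  obtains u where "norm (f u) < c * norm u"
  using assms unfolding bounded_below_def by (auto simp: not_le)

lemma self_adjointD:
  assumes "self_adjoint A"
  shows "bounded_linear A" "A u \<bullet> v = u \<bullet> A v"
  using assms unfolding self_adjoint_def by auto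

lemma self_adjoint_shift:
  assumes "self_adjoint A"
  shows "self_adjoint (\<lambda>u. A u - x *\<^sub>R u)"
  using assms unfolding self_adjoint_def
  by (auto simp: inner_diff_left inner_diff_right intro!: bounded_linear_sub bounded_linear_scaleR_right
      bounded_linear_ident)

lemma self_adjoint_square:
  assumes "self_adjoint A"
  shows "self_adjoint (\<lambda>u. A (A u))"
  using assms unfolding self_adjoint_def
  by (auto intro: bounded_linear_compose)

lemma self_adjoint_norm_square:
  assumes "self_adjoint A"
  shows "A (A u) \<bullet> u = (norm (A u))\<^sup>2"
  using self_adjointD(2)[OF assms, of "A u" u] by (simp add: power2_norm_eq_inner)

lemma norm_diff_scaleR_square:
  fixes x y :: "'a::real_inner"
  shows "(norm (x - k *\<^sub>R y))\<^sup>2 = (norm x)\<^sup>2 - 2 * k * (y \<bullet> x) + k\<^sup>2 * (norm y)\<^sup>2"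
  unfolding power2_norm_eq_inner
  by (simp add: inner_diff_left inner_diff_right inner_commute[of x y] power2_eq_square algebra_simps)

lemma bounded_below_compose:
  assumes "bounded_below f" "bounded_below g"
  shows "bounded_below (\<lambda>u. f (g u))"
proof -
  obtain c d where c: "c > 0" "\<And>u. c * norm u \<le> norm (f u)"
    and d: "d > 0" "\<And>u. d * norm u \<le> norm (g u)"
    using assms by (metis bounded_belowE)
  have "c * d * norm u \<le> norm (f (g u))" for u
    using order_trans[OF mult_left_mono[OF d(2)[of u], of c] c(2)] c(1) by (simp add: mult.assoc)
  then show ?thesis
    unfolding bounded_below_def using c(1) d(1) by (intro exI[of _ "c * d"]) auto
qed

text \<open>With \<open>d = inf \<parallel>B u\<parallel> / \<parallel>u\<parallel>\<close>, the operator \<open>B\<^sup>2 - d\<^sup>2 = (B - d) (B + d)\<close> is nonnegative and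
  its quadratic form has infimum 0; nonnegativity bounds \<open>\<parallel>Q u\<parallel>\<^sup>2\<close> by a multiple of
  \<open>\<langle>Q u, u\<rangle>\<close>, so one of the factors is not bounded below.\<close>

lemma self_adjoint_approx_eigenvalue:
  fixes B :: "'a::real_inner \<Rightarrow> 'a"
  assumes B: "self_adjoint B" and u0: "norm (B u0) < c * norm u0"
  obtains d where "\<bar>d\<bar> < c" "\<not> bounded_below (\<lambda>u. B u - d *\<^sub>R u)"
proof -
  interpret B: bounded_linear B using self_adjointD(1)[OF B] .
  define S where "S = (\<lambda>u. norm (B u) / norm u) ` {u. u \<noteq> 0}"
  define d where "d = Inf S"
  have u0': "u0 \<noteq> 0" using u0 by auto
  then have ne: "S \<noteq> {}" unfolding S_def by auto
  have bdd: "bdd_below S" unfolding S_def by (intro bdd_belowI[of _ 0]) auto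
  have d0: "d \<ge> 0" unfolding d_def using ne by (intro cInf_greatest) (auto simp: S_def)
  have "d \<le> norm (B u0) / norm u0"
    unfolding d_def using u0' by (intro cInf_lower bdd) (auto simp: S_def)
  also have "\<dots> < c" using u0 u0' by (simp add: divide_simps)
  finally have dc: "d < c" .
  have dle: "d * norm u \<le> norm (B u)" for u
  proof (cases "u = 0")
    case False
    then have "d \<le> norm (B u) / norm u"
      unfolding d_def by (intro cInf_lower bdd) (auto simp: S_def)
    then show ?thesis using False by (simp add: divide_simps mult.commute)
  qed simp
  have "\<not> (bounded_below (\<lambda>u. B u - d *\<^sub>R u) \<and> bounded_below (\<lambda>u. B u - (-d) *\<^sub>R u))"
  proof
    assume *: "bounded_below (\<lambda>u. B u - d *\<^sub>R u) \<and> bounded_below (\<lambda>u. B u - (-d) *\<^sub>R u)"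
    define Q where "Q = (\<lambda>u. B (B u) - d\<^sup>2 *\<^sub>R u)"
    have saQ: "self_adjoint Q"
      unfolding Q_def by (intro self_adjoint_shift self_adjoint_square B)
    interpret Q: bounded_linear Q using self_adjointD(1)[OF saQ] .
    have "bounded_below (\<lambda>u. B (B u - (-d) *\<^sub>R u) - d *\<^sub>R (B u - (-d) *\<^sub>R u))"
      by (rule bounded_below_compose[of "\<lambda>u. B u - d *\<^sub>R u" "\<lambda>u. B u - (-d) *\<^sub>R u"]) (use * in auto)
    also have "(\<lambda>u. B (B u - (-d) *\<^sub>R u) - d *\<^sub>R (B u - (-d) *\<^sub>R u)) = Q"
      by (auto simp: Q_def B.add B.scaleR power2_eq_square algebra_simps)
    finally obtain f where f: "f > 0" "\<And>u. f * norm u \<le> norm (Q u)"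
      by (elim bounded_belowE) auto
    obtain K where K: "K > 0" "\<And>u. norm (Q u) \<le> K * norm u"
      using Q.pos_bounded by (auto simp: mult.commute)
    have form: "Q u \<bullet> u = (norm (B u))\<^sup>2 - d\<^sup>2 * (norm u)\<^sup>2" for u
      by (simp add: Q_def inner_diff_left self_adjoint_norm_square[OF B] power2_norm_eq_inner)
    have nonneg: "Q u \<bullet> u \<ge> 0" for u
      using power_mono[OF dle[of u], of 2] d0 by (simp add: form power_mult_distrib)
    \<comment> \<open>Evaluating the nonnegative form of \<open>Q\<close> at
      \<open>u - Q u / K\<close> gives
      \<open>(norm (Q u))\<^sup>2 \<le> K * (Q u \<bullet> u)\<close>. With the lower bound
      \<open>f\<close> for \<open>Q\<close>, this lifts the infimum of
      \<open>norm (B u) / norm u\<close> strictly above \<open>d\<close>, a contradiction.\<close>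
    have key: "(d\<^sup>2 + f\<^sup>2 / K) * (norm u)\<^sup>2 \<le> (norm (B u))\<^sup>2" for u
    proof -
      have "0 \<le> Q (u - (1/K) *\<^sub>R Q u) \<bullet> (u - (1/K) *\<^sub>R Q u)" by (rule nonneg)
      also have "\<dots> = Q u \<bullet> u - 2 / K * (Q u \<bullet> Q u) + (1/K)\<^sup>2 * (Q (Q u) \<bullet> Q u)"
        using self_adjointD(2)[OF saQ, of "Q u" u]
        by (simp add: Q.diff Q.scaleR inner_diff_left inner_diff_right power2_eq_square algebra_simps)
      finally have 1: "0 \<le> Q u \<bullet> u - 2 / K * (norm (Q u))\<^sup>2 + (1/K)\<^sup>2 * (Q (Q u) \<bullet> Q u)"
        by (simp add: power2_norm_eq_inner)
      have "Q (Q u) \<bullet> Q u \<le> norm (Q (Q u)) * norm (Q u)" by (rule norm_cauchy_schwarz)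
      also have "\<dots> \<le> K * (norm (Q u))\<^sup>2"
        using mult_right_mono[OF K(2)[of "Q u"], of "norm (Q u)"] by (simp add: power2_eq_square mult.assoc)
      finally have "(1/K)\<^sup>2 * (Q (Q u) \<bullet> Q u) \<le> (1/K)\<^sup>2 * (K * (norm (Q u))\<^sup>2)"
        by (intro mult_left_mono) auto
      also have "\<dots> = 1/K * (norm (Q u))\<^sup>2" using K(1) by (simp add: power2_eq_square)
      finally have 2: "1/K * (norm (Q u))\<^sup>2 \<le> Q u \<bullet> u" using 1 by simp
      have "1/K * (f * norm u)\<^sup>2 \<le> 1/K * (norm (Q u))\<^sup>2"
        using f K(1) by (intro mult_left_mono power_mono) auto
      with 2 show ?thesis by (simp add: form power_mult_distrib algebra_simps)
    qed
    define e where "e = sqrt (d\<^sup>2 + f\<^sup>2 / K)"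
    have "e > d" unfolding e_def using d0 K(1) f(1) by (intro real_less_rsqrt) auto
    have "e \<le> norm (B u) / norm u" if "u \<noteq> 0" for u
    proof -
      have "(e * norm u)\<^sup>2 \<le> (norm (B u))\<^sup>2"
        using key[of u] K(1) by (simp add: e_def power_mult_distrib)
      then have "e * norm u \<le> norm (B u)" by (rule power2_le_imp_le) auto
      then show ?thesis using that by (simp add: divide_simps)
    qed
    then have "e \<le> d" unfolding d_def using ne by (intro cInf_greatest) (auto simp: S_def)
    with \<open>e > d\<close> show False by simp
  qed
  then show ?thesis using that[of d] that[of "-d"] d0 dc by auto
qed

text \<open>The equation is a fixed point problem for \<open>x - (B (B x) - y) / K\<^sup>2\<close>,
  a contraction because the form of \<open>B\<^sup>2\<close> lies between
  \<open>\<delta>\<^sup>2\<close> and \<open>K\<^sup>2\<close> on \<open>R\<close>; \<open>B\<close>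
  itself may be indefinite, which is why its square is used. The subspace \<open>R\<close> allows
  for a nontrivial kernel: it is the whole space in one application and the closure of the range in
  another.\<close>

lemma self_adjoint_square_surj:
  fixes B :: "'a::real_inner \<Rightarrow> 'a"
  assumes B: "self_adjoint B" and R: "complete R" "subspace R" "\<And>v. v \<in> R \<Longrightarrow> B v \<in> R"
    and \<delta>: "\<delta> > 0" "\<And>v. v \<in> R \<Longrightarrow> \<delta> * norm v \<le> norm (B v)" and y: "y \<in> R"
  obtains x where "x \<in> R" "B (B x) = y"
proof -
  interpret B: bounded_linear B using self_adjointD(1)[OF B] .
  obtain K0 where K0: "K0 > 0" "\<And>u. norm (B u) \<le> K0 * norm u"
    using B.pos_bounded by (auto simp: mult.commute)
  \<comment> \<open>For trivial \<open>R\<close>, \<open>\<delta>\<close> may exceed the operator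
    norm; the maximum keeps the radicand of \<open>q\<close> nonnegative.\<close>
  define K where "K = max K0 \<delta>"
  have K: "K > 0" "K \<ge> \<delta>" and Kb: "norm (B u) \<le> K * norm u" for u
    using K0(1) order_trans[OF K0(2)[of u] mult_right_mono[of K0 K "norm u"]] by (auto simp: K_def)
  define q where "q = sqrt (1 - \<delta>\<^sup>2 / K\<^sup>2)"
  have le1: "\<delta>\<^sup>2 / K\<^sup>2 \<le> 1" using K \<delta>(1) by (auto simp: power_mono)
  then have q: "0 \<le> q" "q < 1" "q\<^sup>2 = 1 - \<delta>\<^sup>2 / K\<^sup>2" using \<delta>(1) K(1) by (auto simp: q_def)
  \<comment> \<open>In the expanded square, the cross term yields
    \<open>- 2 / K\<^sup>2 * (norm (B v))\<^sup>2\<close> by symmetry and the last term costs at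
    most half of it; the lower bound \<open>\<delta>\<close> is applied to what remains.\<close>
  have contr: "norm (v - (1 / K\<^sup>2) *\<^sub>R B (B v)) \<le> q * norm v" if "v \<in> R" for v
  proof (rule power2_le_imp_le)
    have "(norm (B (B v)))\<^sup>2 \<le> (K * norm (B v))\<^sup>2"
      by (intro power_mono Kb) auto
    then have "(1 / K\<^sup>2)\<^sup>2 * (norm (B (B v)))\<^sup>2 \<le> (1 / K\<^sup>2)\<^sup>2 * (K * norm (B v))\<^sup>2"
      by (intro mult_left_mono) auto
    also have "\<dots> = 1 / K\<^sup>2 * (norm (B v))\<^sup>2" using K(1) by (simp add: power2_eq_square field_simps)
    finally have 1: "(1 / K\<^sup>2)\<^sup>2 * (norm (B (B v)))\<^sup>2 \<le> 1 / K\<^sup>2 * (norm (B v))\<^sup>2" .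
    have "(norm (v - (1 / K\<^sup>2) *\<^sub>R B (B v)))\<^sup>2
        = (norm v)\<^sup>2 - 2 / K\<^sup>2 * (B (B v) \<bullet> v) + (1 / K\<^sup>2)\<^sup>2 * (norm (B (B v)))\<^sup>2"
      by (simp add: norm_diff_scaleR_square)
    also have "\<dots> \<le> (norm v)\<^sup>2 - 1 / K\<^sup>2 * (norm (B v))\<^sup>2"
      using 1 by (simp add: self_adjoint_norm_square[OF B])
    also have "\<dots> \<le> (norm v)\<^sup>2 - 1 / K\<^sup>2 * (\<delta> * norm v)\<^sup>2"
      using \<delta> that by (intro diff_left_mono mult_left_mono power_mono) auto
    also have "\<dots> = (q * norm v)\<^sup>2"
      by (simp add: power_mult_distrib q(3) algebra_simps)
    finally show "(norm (v - (1 / K\<^sup>2) *\<^sub>R B (B v)))\<^sup>2 \<le> (q * norm v)\<^sup>2" .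
  qed (use q in auto)
  define g where "g x = x - (1 / K\<^sup>2) *\<^sub>R (B (B x) - y)" for x
  have "\<exists>!x\<in>R. g x = x"
  proof (rule Banach_fix[OF R(1) _ q(1,2)])
    show "g ` R \<subseteq> R"
      unfolding g_def using R(2,3) y
      by (auto intro!: subspace_diff[OF R(2)] subspace_scale[OF R(2)])
    show "dist (g x) (g x') \<le> q * dist x x'" if "x \<in> R" "x' \<in> R" for x x'
    proof -
      have "g x - g x' = (x - x') - (1 / K\<^sup>2) *\<^sub>R B (B (x - x'))"
        by (simp add: g_def B.diff algebra_simps)
      then show ?thesis using contr[of "x - x'"] that subspace_diff[OF R(2)] by (simp add: dist_norm)
    qed
  qed (use y in auto)
  then obtain x where "x \<in> R" "g x = x" by blast
  then show ?thesis using that[of x] K(1) by (simp add: g_def)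
qed

text \<open>A solution of \<open>B (B x) = y\<close> already exhibits \<open>y\<close> as a value of
  \<open>B\<close>; injectivity is immediate from the lower bound.\<close>

lemma self_adjoint_bij:
  fixes B :: "'a::{real_inner,complete_space} \<Rightarrow> 'a"
  assumes B: "self_adjoint B" and bb: "bounded_below B"
  shows "bij B"
proof -
  interpret B: bounded_linear B using self_adjointD(1)[OF B] .
  obtain c where c: "c > 0" "\<And>u. c * norm u \<le> norm (B u)" using bounded_belowE[OF bb] by blast
  have "u = v" if "B u = B v" for u v
    using c(2)[of "u - v"] c(1) that by (auto simp: B.diff mult_le_0_iff)
  moreover have "\<exists>x. y = B x" for y
    using self_adjoint_square_surj[OF B complete_UNIV subspace_UNIV _ c] by (metis UNIV_I)
  ultimately show ?thesis by (auto simp: bij_def inj_def surj_def)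
qed

text \<open>The spectrum of \<open>B\<^sup>2\<close> avoids the open interval from 0 to \<open>\<delta>\<^sup>2\<close>, hence
  \<open>\<parallel>(B\<^sup>2 - \<delta>\<^sup>2/2) u\<parallel> \<ge> \<delta>\<^sup>2/2 \<parallel>u\<parallel>\<close> by the lemma on approximate eigenvalues.\<close>

lemma self_adjoint_gap:
  fixes B :: "'a::real_inner \<Rightarrow> 'a"
  assumes B: "self_adjoint B" and \<delta>: "\<delta> > 0"
    and gap: "\<And>d. 0 < \<bar>d\<bar> \<Longrightarrow> \<bar>d\<bar> < \<delta> \<Longrightarrow> bounded_below (\<lambda>u. B u - d *\<^sub>R u)"
  shows "\<delta> * norm (B u) \<le> norm (B (B u))"
proof -
  interpret B: bounded_linear B using self_adjointD(1)[OF B] .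
  \<comment> \<open>The midpoint of the gap of \<open>B\<^sup>2\<close>: for
    \<open>\<bar>d\<bar> < s\<close>, the number \<open>s + d\<close> ranges over exactly this
    gap.\<close>
  define s where "s = \<delta>\<^sup>2 / 2"
  have s: "s > 0" using \<delta> by (simp add: s_def)
  have "s * norm u \<le> norm (B (B u) - s *\<^sub>R u)"
  proof (rule ccontr)
    assume "\<not> s * norm u \<le> norm (B (B u) - s *\<^sub>R u)"
    moreover have "self_adjoint (\<lambda>u. B (B u) - s *\<^sub>R u)"
      by (intro self_adjoint_shift self_adjoint_square B)
    ultimately obtain d where d: "\<bar>d\<bar> < s" "\<not> bounded_below (\<lambda>u. B (B u) - s *\<^sub>R u - d *\<^sub>R u)"
      using self_adjoint_approx_eigenvalue[of "\<lambda>u. B (B u) - s *\<^sub>R u" u s] by (auto simp: not_le)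
    \<comment> \<open>\<open>B\<^sup>2 - (s + d)\<close> factors as \<open>(B - r) (B + r)\<close>,
      and both \<open>r\<close> and \<open>- r\<close> fall under the hypothesis
      \<open>gap\<close>.\<close>
    define r where "r = sqrt (s + d)"
    have r: "0 < r" "r\<^sup>2 = s + d" using d(1) by (auto simp: r_def)
    have "r\<^sup>2 < \<delta>\<^sup>2" using d(1) unfolding r(2) by (simp add: s_def)
    then have "r < \<delta>" using \<delta> by (simp add: power_less_imp_less_base)
    then have "bounded_below (\<lambda>u. B u - r *\<^sub>R u)" "bounded_below (\<lambda>u. B u - (- r) *\<^sub>R u)"
      using r(1) by (intro gap; simp)+
    from bounded_below_compose[OF this]
    have "bounded_below (\<lambda>u. B (B u - (-r) *\<^sub>R u) - r *\<^sub>R (B u - (-r) *\<^sub>R u))" .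
    also have "(\<lambda>u. B (B u - (-r) *\<^sub>R u) - r *\<^sub>R (B u - (-r) *\<^sub>R u))
        = (\<lambda>u. B (B u) - s *\<^sub>R u - d *\<^sub>R u)"
    proof
      fix u
      have "B (B u - (-r) *\<^sub>R u) - r *\<^sub>R (B u - (-r) *\<^sub>R u) = B (B u) - (r\<^sup>2) *\<^sub>R u"
        by (simp add: B.add B.scaleR power2_eq_square algebra_simps)
      then show "B (B u - (-r) *\<^sub>R u) - r *\<^sub>R (B u - (-r) *\<^sub>R u) = B (B u) - s *\<^sub>R u - d *\<^sub>R u"
        by (simp add: r(2) algebra_simps)
    qed
    finally show False using d(2) by simp
  qed
  \<comment> \<open>After squaring, the terms \<open>(s * norm u)\<^sup>2\<close> cancel and
    \<open>2 * s = \<delta>\<^sup>2\<close> remains as the factor of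
    \<open>(norm (B u))\<^sup>2\<close>.\<close>
  then have "(s * norm u)\<^sup>2 \<le> (norm (B (B u) - s *\<^sub>R u))\<^sup>2"
    using s by (intro power_mono) auto
  also have "\<dots> = (norm (B (B u)))\<^sup>2 - 2 * s * (B (B u) \<bullet> u) + (s * norm u)\<^sup>2"
    by (simp add: norm_diff_scaleR_square power_mult_distrib inner_commute)
  finally have "(\<delta> * norm (B u))\<^sup>2 \<le> (norm (B (B u)))\<^sup>2"
    by (simp add: self_adjoint_norm_square[OF B] s_def power_mult_distrib)
  then show ?thesis by (rule power2_le_imp_le) auto
qed

lemma subspace_closure:
  fixes S :: "'a::real_normed_vector set"
  assumes "subspace S"
  shows "subspace (closure S)"
  unfolding subspace_def
proof (intro conjI ballI allI)
  show "0 \<in> closure S"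
    using subspace_0[OF assms] closure_subset by blast
next
  fix x y assume "x \<in> closure S" "y \<in> closure S"
  then obtain f g where "\<And>n. f n \<in> S" "f \<longlonglongrightarrow> x" "\<And>n. g n \<in> S" "g \<longlonglongrightarrow> y"
    unfolding closure_sequential by blast
  then show "x + y \<in> closure S"
    unfolding closure_sequential
    by (intro exI[of _ "\<lambda>n. f n + g n"]) (auto intro: tendsto_add subspace_add[OF assms])
next
  fix c :: real and x assume "x \<in> closure S"
  then obtain f where "\<And>n. f n \<in> S" "f \<longlonglongrightarrow> x"
    unfolding closure_sequential by blast
  then show "c *\<^sub>R x \<in> closure S"
    unfolding closure_sequential
    by (intro exI[of _ "\<lambda>n. c *\<^sub>R f n"]) (auto intro: tendsto_scaleR subspace_scale[OF assms])
qed

text \<open>The gap bounds \<open>B\<close> below by \<open>\<delta>\<close> on its range, hence on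
  the closure \<open>R\<close> of the range. Solving \<open>B (B w) = B (B u)\<close> with
  \<open>w\<close> in \<open>R\<close> splits off the component of \<open>u\<close> in
  \<open>R\<close>, and \<open>p = u - w\<close> lies in the kernel. This stands in for the
  orthogonal projection onto the kernel.\<close>

lemma self_adjoint_near_kernel:
  fixes B :: "'a::{real_inner,complete_space} \<Rightarrow> 'a"
  assumes B: "self_adjoint B" and \<delta>: "\<delta> > 0"
    and gap: "\<And>d. 0 < \<bar>d\<bar> \<Longrightarrow> \<bar>d\<bar> < \<delta> \<Longrightarrow> bounded_below (\<lambda>u. B u - d *\<^sub>R u)"
  obtains p where "B p = 0" "\<delta> * norm (u - p) \<le> norm (B u)"
proof -
  interpret B: bounded_linear B using self_adjointD(1)[OF B] .
  define R where "R = closure (range B)"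
  have R: "subspace R" "complete R" "range B \<subseteq> R"
    using subspace_UNIV
    by (auto simp: R_def complete_eq_closed closure_subset
        intro!: subspace_closure linear_subspace_image B.linear_axioms)
  have inv: "B v \<in> R" for v using R(3) by auto
  have "R \<subseteq> {v. \<delta> * norm v \<le> norm (B v)}"
    unfolding R_def
  proof (rule closure_minimal)
    show "range B \<subseteq> {v. \<delta> * norm v \<le> norm (B v)}" using self_adjoint_gap[OF B \<delta> gap] by auto
    show "closed {v. \<delta> * norm v \<le> norm (B v)}"
      by (intro closed_Collect_le continuous_intros B.continuous_on)
  qed
  then have low: "\<delta> * norm v \<le> norm (B v)" if "v \<in> R" for v using that by auto
  obtain w where w: "w \<in> R" "B (B w) = B (B u)"
    using self_adjoint_square_surj[OF B R(2,1) inv \<delta> low inv] by blast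
  have "B (B (w - u)) = 0" using w(2) by (simp add: B.diff)
  then have "B (w - u) = 0"
    using self_adjoint_norm_square[OF B, of "w - u"] by simp
  then have "B w = B u" by (simp add: B.diff)
  then show ?thesis using that[of "u - w"] low[OF w(1)] by (simp add: B.diff)
qed

section \<open>The Hilbert space of square-summable functions\<close>

text \<open>As a type, \<open>ell2\<close> becomes an instance of the classes for which the operator
  results above are stated.\<close>

typedef 'a l2 = "ell2 :: ('a \<Rightarrow> complex) set"
  morphisms l2_fun Abs_l2
  by (rule exI[of _ "\<lambda>_. 0"]) (simp add: ell2_def)

setup_lifting type_definition_l2

lemma ell2_add:
  assumes "u \<in> ell2" "v \<in> ell2"
  shows "(\<lambda>n. u n + v n) \<in> ell2"
  unfolding ell2_def mem_Collect_eq
proof (rule summable_on_comparison_test)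
  show "(\<lambda>n. 2 * (cmod (u n))\<^sup>2 + 2 * (cmod (v n))\<^sup>2) summable_on UNIV"
    using assms by (intro summable_on_add summable_on_cmult_right) (auto simp: ell2_def)
  show "(cmod (u n + v n))\<^sup>2 \<le> 2 * (cmod (u n))\<^sup>2 + 2 * (cmod (v n))\<^sup>2" for n
  proof -
    have "(cmod (u n + v n))\<^sup>2 \<le> (cmod (u n) + cmod (v n))\<^sup>2"
      by (intro power_mono norm_triangle_ineq) auto
    also have "\<dots> \<le> 2 * (cmod (u n))\<^sup>2 + 2 * (cmod (v n))\<^sup>2"
      using sum_squares_bound[of "cmod (u n)" "cmod (v n)"] by (simp add: power2_sum)
    finally show ?thesis .
  qed
qed auto

lemma ell2_mult:
  assumes "bounded (range f)" "u \<in> ell2"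
  shows "(\<lambda>n. f n * u n) \<in> ell2"
  unfolding ell2_def mem_Collect_eq
proof -
  obtain K where K: "\<And>n. cmod (f n) \<le> K" using assms(1) by (auto simp: bounded_iff)
  show "(\<lambda>n. (cmod (f n * u n))\<^sup>2) summable_on UNIV"
  proof (rule summable_on_comparison_test)
    show "(\<lambda>n. K\<^sup>2 * (cmod (u n))\<^sup>2) summable_on UNIV"
      using assms(2) by (intro summable_on_cmult_right) (auto simp: ell2_def)
    show "(cmod (f n * u n))\<^sup>2 \<le> K\<^sup>2 * (cmod (u n))\<^sup>2" for n
      unfolding norm_mult power_mult_distrib using K by (intro mult_right_mono power_mono) auto
  qed auto
qed

lemma ell2_inner_summable:
  assumes "u \<in> ell2" "v \<in> ell2"
  shows "(\<lambda>n. u n \<bullet> v n) summable_on UNIV"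
proof -
  have "(\<lambda>n. norm (u n \<bullet> v n)) summable_on UNIV"
  proof (rule Infinite_Sum.abs_summable_on_comparison_test')
    show "(\<lambda>n. (cmod (u n))\<^sup>2 + (cmod (v n))\<^sup>2) summable_on UNIV"
      using assms by (intro summable_on_add) (auto simp: ell2_def)
    show "norm (u n \<bullet> v n) \<le> (cmod (u n))\<^sup>2 + (cmod (v n))\<^sup>2" for n
    proof -
      have "norm (u n \<bullet> v n) \<le> cmod (u n) * cmod (v n)"
        using Cauchy_Schwarz_ineq2[of "u n" "v n"] by simp
      also have "\<dots> \<le> (cmod (u n))\<^sup>2 + (cmod (v n))\<^sup>2"
        using sum_squares_bound[of "cmod (u n)" "cmod (v n)"]
          mult_nonneg_nonneg[OF norm_ge_zero norm_ge_zero, of "u n" "v n"]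
        by linarith
      finally show ?thesis .
    qed
  qed
  then show ?thesis by (rule abs_summable_summable)
qed

lemma ell2_reindex:
  assumes "bij g" "u \<in> ell2"
  shows "(\<lambda>n. u (g n)) \<in> ell2"
  using assms summable_on_reindex_bij_betw[of g UNIV UNIV "\<lambda>n. (cmod (u n))\<^sup>2"] by (simp add: ell2_def)

text \<open>Only the real part of the complex inner product is used. Complex scalars act as the operators
  \<open>l2_scale c\<close> defined below, and a symmetric operator for the real inner product that commutes
  with them is symmetric for the complex one.\<close>

instantiation l2 :: (type) real_inner
begin

lift_definition zero_l2 :: "'a l2" is "\<lambda>_. 0" by (simp add: ell2_def)

lift_definition plus_l2 :: "'a l2 \<Rightarrow> 'a l2 \<Rightarrow> 'a l2" is "\<lambda>u v n. u n + v n" by (rule ell2_add)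

lift_definition uminus_l2 :: "'a l2 \<Rightarrow> 'a l2" is "\<lambda>u n. - u n" by (simp add: ell2_def)

lift_definition minus_l2 :: "'a l2 \<Rightarrow> 'a l2 \<Rightarrow> 'a l2" is "\<lambda>u v n. u n - v n"
proof -
  fix u v :: "'a \<Rightarrow> complex" assume "u \<in> ell2" "v \<in> ell2"
  then show "(\<lambda>n. u n - v n) \<in> ell2"
    using ell2_add[of u "\<lambda>n. - v n"] by (simp add: ell2_def)
qed

lift_definition scaleR_l2 :: "real \<Rightarrow> 'a l2 \<Rightarrow> 'a l2" is "\<lambda>c u n. c *\<^sub>R u n"
  using ell2_mult[of "\<lambda>_. of_real _"] by (simp add: scaleR_conv_of_real)

lift_definition inner_l2 :: "'a l2 \<Rightarrow> 'a l2 \<Rightarrow> real" is "\<lambda>u v. \<Sum>\<^sub>\<infinity>n. u n \<bullet> v n" .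

lift_definition norm_l2 :: "'a l2 \<Rightarrow> real" is ell2_norm .

definition dist_l2 :: "'a l2 \<Rightarrow> 'a l2 \<Rightarrow> real" where "dist_l2 u v = norm (u - v)"

definition sgn_l2 :: "'a l2 \<Rightarrow> 'a l2" where "sgn_l2 u = inverse (norm u) *\<^sub>R u"

definition uniformity_l2 :: "('a l2 \<times> 'a l2) filter" where
  "uniformity_l2 = (INF e\<in>{0<..}. principal {(u, v). dist u v < e})"

definition open_l2 :: "'a l2 set \<Rightarrow> bool" where
  "open_l2 U = (\<forall>x\<in>U. eventually (\<lambda>(x', y). x' = x \<longrightarrow> y \<in> U) uniformity)"

instance
proof
  fix u v w :: "'a l2" and r s :: real
  show "u + v + w = u + (v + w)" by transfer (simp add: add.assoc)
  show "u + v = v + u" by transfer (simp add: add.commute)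
  show "0 + u = u" by transfer simp
  show "- u + u = 0" by transfer simp
  show "u - v = u + - v" by transfer simp
  show "r *\<^sub>R (u + v) = r *\<^sub>R u + r *\<^sub>R v" by transfer (simp add: algebra_simps)
  show "(r + s) *\<^sub>R u = r *\<^sub>R u + s *\<^sub>R u" by transfer (simp add: algebra_simps)
  show "r *\<^sub>R s *\<^sub>R u = (r * s) *\<^sub>R u" by transfer simp
  show "1 *\<^sub>R u = u" by transfer simp
  show "dist u v = norm (u - v)" by (rule dist_l2_def)
  show "sgn u = inverse (norm u) *\<^sub>R u" by (simp add: sgn_l2_def)
  show "uniformity = (INF e\<in>{0<..}. principal {(u :: 'a l2, v). dist u v < e})"
    by (rule uniformity_l2_def)
  show "open U = (\<forall>x\<in>U. \<forall>\<^sub>F (x', y) in uniformity. x' = x \<longrightarrow> y \<in> U)" for U :: "'a l2 set"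
    by (rule open_l2_def)
  show "u \<bullet> v = v \<bullet> u" by transfer (simp add: inner_commute)
  show "(u + v) \<bullet> w = u \<bullet> w + v \<bullet> w"
    by transfer (simp add: inner_add_left infsum_add ell2_inner_summable)
  show "r *\<^sub>R u \<bullet> v = r * (u \<bullet> v)"
    by transfer (simp add: infsum_cmult_right')
  show "0 \<le> u \<bullet> u" by transfer (simp add: infsum_nonneg)
  show "(u \<bullet> u = 0) = (u = 0)"
  proof
    assume "u \<bullet> u = 0"
    then show "u = 0"
    proof transfer
      fix u :: "'a \<Rightarrow> complex" assume u: "u \<in> ell2" "(\<Sum>\<^sub>\<infinity>n. u n \<bullet> u n) = 0"
      then have "u n \<bullet> u n = 0" for n
        using nonneg_infsum_le_0D[of "\<lambda>n. u n \<bullet> u n" UNIV n] ell2_inner_summable[OF u(1) u(1)] by simp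
      then show "u = (\<lambda>_. 0)" by auto
    qed
  qed (transfer, simp)
  show "norm u = sqrt (u \<bullet> u)"
    by transfer (simp add: ell2_norm_def power2_norm_eq_inner)
qed

end

lemma l2_fun_simps [simp]:
  "l2_fun 0 n = 0" "l2_fun (u + v) n = l2_fun u n + l2_fun v n" "l2_fun (- u) n = - l2_fun u n"
  "l2_fun (u - v) n = l2_fun u n - l2_fun v n" "l2_fun (r *\<^sub>R u) n = of_real r * l2_fun u n"
  by (transfer; simp add: scaleR_conv_of_real)+

lemma l2_fun_sum [simp]: "l2_fun (\<Sum>i\<in>I. u i) n = (\<Sum>i\<in>I. l2_fun (u i) n)"
  by (induction I rule: infinite_finite_induct) auto

lemma l2_eqI: "(\<And>n. l2_fun u n = l2_fun v n) \<Longrightarrow> u = v"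
  by transfer auto

lemma l2_norm_square: "(norm u)\<^sup>2 = (\<Sum>\<^sub>\<infinity>n. (cmod (l2_fun u n))\<^sup>2)"
  by transfer (simp add: ell2_norm_def infsum_nonneg)

lemma l2_summable: "(\<lambda>n. (cmod (l2_fun u n))\<^sup>2) summable_on UNIV"
  by transfer (simp add: ell2_def)

lemma l2_sum_le_norm:
  assumes "finite F"
  shows "(\<Sum>n\<in>F. (cmod (l2_fun u n))\<^sup>2) \<le> (norm u)\<^sup>2"
  unfolding l2_norm_square using assms by (intro finite_sum_le_infsum l2_summable) auto

lemma l2_coord_le_norm: "cmod (l2_fun u n) \<le> norm u"
  by (rule power2_le_imp_le) (use l2_sum_le_norm[of "{n}" u] in auto)

lemma l2_norm_finite_support:
  assumes "finite F" "\<And>n. n \<notin> F \<Longrightarrow> l2_fun u n = 0"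
  shows "(norm u)\<^sup>2 = (\<Sum>n\<in>F. (cmod (l2_fun u n))\<^sup>2)"
proof -
  have "(\<Sum>\<^sub>\<infinity>n. (cmod (l2_fun u n))\<^sup>2) = (\<Sum>\<^sub>\<infinity>n\<in>F. (cmod (l2_fun u n))\<^sup>2)"
    by (rule infsum_cong_neutral) (use assms in auto)
  then show ?thesis using assms(1) by (simp add: l2_norm_square)
qed

text \<open>Bounds on finite partial sums are what survives a coordinatewise limit; here they
  produce an element of the space together with a norm bound.\<close>

lemma Abs_l2_bounded_sums:
  assumes "\<And>F. finite F \<Longrightarrow> (\<Sum>n\<in>F. (cmod (f n))\<^sup>2) \<le> C\<^sup>2" "C \<ge> 0"
  obtains u where "l2_fun u = f" "norm u \<le> C"
proof -
  have "(\<lambda>n. (cmod (f n))\<^sup>2) summable_on UNIV"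
    using assms(1) by (intro nonneg_bdd_above_summable_on bdd_aboveI) auto
  then have "f \<in> ell2" by (simp add: ell2_def)
  then obtain u where u: "l2_fun u = f" using l2_fun_cases by metis
  have "(norm u)\<^sup>2 \<le> C\<^sup>2"
    unfolding l2_norm_square by (rule infsum_le_finite_sums[OF l2_summable]) (use assms(1) u in auto)
  then have "norm u \<le> C" using assms(2) by (rule power2_le_imp_le)
  with u show ?thesis by (rule that)
qed

text \<open>The coordinatewise limit \<open>f\<close> is not known to be square-summable at the
  start. Passing to the limit in finite sums shows that \<open>X m - f\<close> is square-summable
  with small norm for large \<open>m\<close> (\<open>tail\<close>); one such \<open>m\<close> puts
  \<open>f\<close> into the space, and all of them give convergence.\<close>

instance l2 :: (type) complete_space
proof
  fix X :: "nat \<Rightarrow> 'a l2" assume X: "Cauchy X"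
  have "Cauchy (\<lambda>k. l2_fun (X k) n)" for n
    unfolding Cauchy_def
  proof (intro allI impI)
    fix e :: real assume "e > 0"
    then obtain M where M: "\<And>m k. m \<ge> M \<Longrightarrow> k \<ge> M \<Longrightarrow> dist (X m) (X k) < e"
      using X unfolding Cauchy_def by blast
    have "dist (l2_fun (X m) n) (l2_fun (X k) n) \<le> dist (X m) (X k)" for m k
      using l2_coord_le_norm[of "X m - X k" n] by (simp add: dist_norm)
    then show "\<exists>M. \<forall>m\<ge>M. \<forall>k\<ge>M. dist (l2_fun (X m) n) (l2_fun (X k) n) < e"
      using M by (meson order_le_less_trans)
  qed
  then have "\<exists>l. (\<lambda>k. l2_fun (X k) n) \<longlonglongrightarrow> l" for n
    by (simp add: Cauchy_convergent_iff convergent_def)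
  then obtain f where f: "\<And>n. (\<lambda>k. l2_fun (X k) n) \<longlonglongrightarrow> f n" by metis
  have tail: "\<exists>M. \<forall>m\<ge>M. \<exists>u. l2_fun u = (\<lambda>n. l2_fun (X m) n - f n) \<and> norm u \<le> e"
    if "e > 0" for e
  proof -
    obtain M where M: "\<And>m k. m \<ge> M \<Longrightarrow> k \<ge> M \<Longrightarrow> dist (X m) (X k) < e"
      using X \<open>e > 0\<close> unfolding Cauchy_def by blast
    have "\<exists>u. l2_fun u = (\<lambda>n. l2_fun (X m) n - f n) \<and> norm u \<le> e" if m: "m \<ge> M" for m
    proof -
      have "(\<Sum>n\<in>F. (cmod (l2_fun (X m) n - f n))\<^sup>2) \<le> e\<^sup>2" if "finite F" for F
      proof (rule tendsto_upperbound)
        show "(\<lambda>k. \<Sum>n\<in>F. (cmod (l2_fun (X m) n - l2_fun (X k) n))\<^sup>2)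
            \<longlonglongrightarrow> (\<Sum>n\<in>F. (cmod (l2_fun (X m) n - f n))\<^sup>2)"
          by (intro tendsto_intros f)
        show "\<forall>\<^sub>F k in sequentially. (\<Sum>n\<in>F. (cmod (l2_fun (X m) n - l2_fun (X k) n))\<^sup>2) \<le> e\<^sup>2"
          using eventually_ge_at_top[of M]
        proof eventually_elim
          case (elim k)
          have "(\<Sum>n\<in>F. (cmod (l2_fun (X m - X k) n))\<^sup>2) \<le> (norm (X m - X k))\<^sup>2"
            by (rule l2_sum_le_norm[OF that])
          also have "\<dots> \<le> e\<^sup>2"
            using M[OF m elim] by (intro power_mono) (auto simp: dist_norm)
          finally show ?case by simp
        qed
      qed simp
      then obtain u where "l2_fun u = (\<lambda>n. l2_fun (X m) n - f n)" "norm u \<le> e"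
        using Abs_l2_bounded_sums[of "\<lambda>n. l2_fun (X m) n - f n" e] \<open>e > 0\<close> by auto
      then show ?thesis by blast
    qed
    then show ?thesis by blast
  qed
  obtain M w where w: "l2_fun w = (\<lambda>n. l2_fun (X M) n - f n)"
    using tail[of 1] by auto
  define x where "x = X M - w"
  have x: "l2_fun x n = f n" for n by (simp add: x_def w)
  have "X \<longlonglongrightarrow> x"
    unfolding LIMSEQ_def
  proof (intro allI impI)
    fix e :: real assume "e > 0"
    then obtain M where M: "\<And>m. m \<ge> M \<Longrightarrow> \<exists>u. l2_fun u = (\<lambda>n. l2_fun (X m) n - f n) \<and> norm u \<le> e / 2"
      using tail[of "e / 2"] by auto
    have "dist (X m) x < e" if "m \<ge> M" for m
    proof -
      from M[OF that] obtain u where u: "l2_fun u = (\<lambda>n. l2_fun (X m) n - f n)" "norm u \<le> e / 2"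
        by blast
      have "X m - x = u" by (rule l2_eqI) (simp add: u x)
      then show ?thesis using u(2) \<open>e > 0\<close> by (simp add: dist_norm)
    qed
    then show "\<exists>no. \<forall>n\<ge>no. dist (X n) x < e" by blast
  qed
  then show "convergent X" by (auto simp: convergent_def)
qed

text \<open>The value 0 for unbounded \<open>f\<close> makes the operator total, and it remains
  bounded and linear for every \<open>f\<close>.\<close>

lift_definition l2_mult :: "('a \<Rightarrow> complex) \<Rightarrow> 'a l2 \<Rightarrow> 'a l2" is
  "\<lambda>f u n. if bounded (range f) then f n * u n else 0"
proof -
  fix f u :: "'a \<Rightarrow> complex" assume "u \<in> ell2"
  then show "(\<lambda>n. if bounded (range f) then f n * u n else 0) \<in> ell2"
    using ell2_mult[of f u] by (cases "bounded (range f)") (auto simp: ell2_def)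
qed

lift_definition l2_shift :: "'a::ab_group_add \<Rightarrow> 'a l2 \<Rightarrow> 'a l2" is "\<lambda>e u n. u (n + e)"
  by (rule ell2_reindex) (rule bij_plus_right)

lemma l2_fun_mult [simp]: "bounded (range f) \<Longrightarrow> l2_fun (l2_mult f u) n = f n * l2_fun u n"
  by transfer simp

lemma l2_fun_shift [simp]: "l2_fun (l2_shift e u) n = l2_fun u (n + e)"
  by transfer simp

lemma norm_l2_shift [simp]: "norm (l2_shift e u) = norm u"
proof (rule power2_eq_imp_eq)
  show "(norm (l2_shift e u))\<^sup>2 = (norm u)\<^sup>2"
    unfolding l2_norm_square l2_fun_shift by (rule infsum_reindex_bij_betw) (rule bij_plus_right)
qed auto

lemma norm_l2_le:
  assumes "\<And>n. cmod (l2_fun u n) \<le> K * cmod (l2_fun v n)" "K \<ge> 0"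
  shows "norm u \<le> K * norm v"
proof (rule power2_le_imp_le)
  have "(\<Sum>\<^sub>\<infinity>n. (cmod (l2_fun u n))\<^sup>2) \<le> (\<Sum>\<^sub>\<infinity>n. K\<^sup>2 * (cmod (l2_fun v n))\<^sup>2)"
    using power_mono[OF assms(1), where n = 2]
    by (intro infsum_mono l2_summable summable_on_cmult_right) (auto simp: power_mult_distrib)
  then show "(norm u)\<^sup>2 \<le> (K * norm v)\<^sup>2"
    by (simp add: l2_norm_square power_mult_distrib infsum_cmult_right')
qed (use assms(2) in auto)

lemma norm_l2_mult_le:
  assumes "\<And>n. cmod (f n) \<le> K"
  shows "norm (l2_mult f u) \<le> K * norm u"
proof (rule norm_l2_le)
  have "bounded (range f)" using assms by (auto simp: bounded_iff)
  then show "cmod (l2_fun (l2_mult f u) n) \<le> K * cmod (l2_fun u n)" for n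
    using assms[of n] by (simp add: norm_mult mult_right_mono)
  show "K \<ge> 0" using assms norm_ge_zero order_trans by blast
qed

lemma bounded_linear_l2_mult: "bounded_linear (l2_mult f)"
proof (cases "bounded (range f)")
  case True
  then obtain K where K: "\<And>n. cmod (f n) \<le> K" by (auto simp: bounded_iff)
  show ?thesis
    by (rule bounded_linear_intro[of _ K])
      (auto intro!: l2_eqI simp: True algebra_simps norm_l2_mult_le[OF K])
next
  case False
  then have "l2_mult f = (\<lambda>_. 0)" by (intro ext l2_eqI) (transfer, simp)
  then show ?thesis by simp
qed

lemma bounded_linear_l2_shift: "bounded_linear (l2_shift e)"
  by (rule bounded_linear_intro[of _ 1]) (auto intro!: l2_eqI)

lemma l2_inner_eq: "u \<bullet> v = (\<Sum>\<^sub>\<infinity>n. l2_fun u n \<bullet> l2_fun v n)"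
  by transfer simp

lemma l2_mult_adjoint:
  assumes "bounded (range f)"
  shows "l2_mult f u \<bullet> v = u \<bullet> l2_mult (\<lambda>n. cnj (f n)) v"
proof -
  have "bounded (range (\<lambda>n. cnj (f n)))"
    using assms by (auto simp: bounded_iff)
  then show ?thesis using assms by (simp add: l2_inner_eq inner_complex_def algebra_simps)
qed

lemma l2_shift_adjoint: "l2_shift e u \<bullet> v = u \<bullet> l2_shift (- e) v"
  using infsum_reindex_bij_betw[OF bij_plus_right[of e], of "\<lambda>n. l2_fun u n \<bullet> l2_fun v (n - e)"]
  by (simp add: l2_inner_eq)

abbreviation l2_scale :: "complex \<Rightarrow> 'a l2 \<Rightarrow> 'a l2" where
  "l2_scale c \<equiv> l2_mult (\<lambda>_. c)"

lemma l2_scale_of_real: "l2_scale (complex_of_real r) u = r *\<^sub>R u"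
  by (rule l2_eqI) simp

lemma norm_l2_scale: "norm (l2_scale c u) = cmod c * norm u"
proof -
  have "(\<Sum>\<^sub>\<infinity>n. (cmod (l2_fun (l2_scale c u) n))\<^sup>2) = (cmod c)\<^sup>2 * (\<Sum>\<^sub>\<infinity>n. (cmod (l2_fun u n))\<^sup>2)"
    by (simp add: norm_mult power_mult_distrib infsum_cmult_right')
  then have "(norm (l2_scale c u))\<^sup>2 = (cmod c * norm u)\<^sup>2"
    by (simp add: l2_norm_square power_mult_distrib)
  then show ?thesis by (rule power2_eq_imp_eq) auto
qed

lemma bounded_range_indicator: "bounded (range (indicator S :: 'a \<Rightarrow> complex))"
  by (auto simp: bounded_iff indicator_def intro!: exI[of _ 1])

text \<open>The squared norm splits into the parts on and off \<open>F\<close>, and the part on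
  \<open>F\<close> is a partial sum that comes arbitrarily close to the total.\<close>

lemma l2_truncate:
  assumes "e > 0"
  obtains F where "finite F" "norm (u - l2_mult (indicator F) u) < e"
proof -
  obtain F where F: "finite F"
    "dist (\<Sum>n\<in>F. (cmod (l2_fun u n))\<^sup>2) (\<Sum>\<^sub>\<infinity>n. (cmod (l2_fun u n))\<^sup>2) \<le> (e/2)\<^sup>2"
    using infsum_finite_approximation[OF l2_summable[of u], of "(e/2)\<^sup>2"] assms by auto
  let ?v = "l2_mult (indicator F) u"
  have v: "l2_fun ?v n = indicator F n * l2_fun u n" for n
    by (simp add: bounded_range_indicator)
  have "(norm u)\<^sup>2 = (\<Sum>\<^sub>\<infinity>n. (cmod (l2_fun (u - ?v) n))\<^sup>2 + (cmod (l2_fun ?v n))\<^sup>2)"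
    unfolding l2_norm_square l2_fun_simps v by (intro infsum_cong) (auto simp: indicator_def)
  also have "\<dots> = (norm (u - ?v))\<^sup>2 + (norm ?v)\<^sup>2"
    unfolding l2_norm_square by (intro infsum_add l2_summable)
  also have "(norm ?v)\<^sup>2 = (\<Sum>n\<in>F. (cmod (l2_fun u n))\<^sup>2)"
    by (subst l2_norm_finite_support[OF F(1)]) (auto simp: v intro!: sum.cong)
  finally have "(norm (u - ?v))\<^sup>2 \<le> (e/2)\<^sup>2"
    using F(2) by (simp add: dist_real_def flip: l2_norm_square)
  then have "norm (u - ?v) \<le> e/2" by (rule power2_le_imp_le) (use assms in auto)
  then show ?thesis using assms by (intro that[OF F(1)]) auto
qed

text \<open>Ties the map \<open>A\<close> on all functions, in terms of which the spectra are
  defined, to an operator \<open>T\<close> on the Hilbert space. Commutation with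
  \<open>l2_scale\<close> makes the real-linear operator \<open>T\<close> complex linear.\<close>

locale ell2_self_adjoint =
  fixes A :: "('a \<Rightarrow> complex) \<Rightarrow> 'a \<Rightarrow> complex" and T :: "'a l2 \<Rightarrow> 'a l2"
  assumes A: "A (l2_fun u) = l2_fun (T u)"
    and T: "self_adjoint T" and scale: "T (l2_scale c u) = l2_scale c (T u)"
begin

sublocale T: bounded_linear T using self_adjointD(1)[OF T] .

text \<open>For real \<open>z\<close> a lower bound already makes \<open>T - z\<close> bijective.
  For nonreal \<open>z\<close>, put \<open>B = T - Re z\<close> and \<open>y = Im z\<close>. Then
  \<open>(norm (L u))\<^sup>2 = (norm (B u))\<^sup>2 + (y * norm u)\<^sup>2\<close>, so
  \<open>L\<close> is bounded below, and \<open>L = B - i y\<close> is onto because its product with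
  \<open>B + i y\<close> is the bijective operator \<open>B\<^sup>2 + y\<^sup>2\<close>.\<close>

lemma ell2_spectrum_iff:
  "z \<in> ell2_spectrum A \<longleftrightarrow> Im z = 0 \<and> \<not> bounded_below (\<lambda>u. T u - Re z *\<^sub>R u)"
proof -
  define L where "L u = T u - l2_scale z u" for u
  have L: "bounded_linear L"
    unfolding L_def by (intro bounded_linear_sub T.bounded_linear_axioms bounded_linear_l2_mult)
  interpret L: bounded_linear L by (rule L)
  have Lfun: "A (l2_fun u) - cscale z (l2_fun u) = l2_fun (L u)" for u
    by (auto simp: L_def A cscale_def)
  have Lscale: "L (l2_scale c u) = l2_scale c (L u)" for c u
    by (rule l2_eqI) (simp add: L_def scale algebra_simps)
  have norm_fun: "ell2_norm (l2_fun u) = norm u" for u :: "'a l2" by transfer simp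
  have ell2_all: "(\<forall>u\<in>ell2. P u) \<longleftrightarrow> (\<forall>u. P (l2_fun u))" for P :: "('a \<Rightarrow> complex) \<Rightarrow> bool"
    by (metis l2_fun l2_fun_cases)
  have fun_plus: "l2_fun u + l2_fun v = l2_fun (u + v)" for u v :: "'a l2" by auto
  have fun_scale: "cscale c (l2_fun u) = l2_fun (l2_scale c u)" for c and u :: "'a l2"
    by (auto simp: cscale_def)
  have 1: "bounded_below L" if res: "z \<in> ell2_resolvent_set A"
  proof -
    obtain R where R: "bounded_ell2_operator R" "\<And>u. R (l2_fun (L u)) = l2_fun u"
      using res unfolding ell2_resolvent_set_def mem_Collect_eq ell2_all Lfun by blast
    then obtain C where C: "\<And>u. ell2_norm (R (l2_fun u)) \<le> C * ell2_norm (l2_fun u)"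
      unfolding bounded_ell2_operator_def ell2_all by blast
    have "norm u \<le> max C 1 * norm (L u)" for u
      using order_trans[OF C[of "L u"] mult_right_mono[of C "max C 1"]] by (simp add: R norm_fun)
    then show ?thesis unfolding bounded_below_def
      by (intro exI[of _ "1 / max C 1"]) (auto simp: divide_simps mult.commute)
  qed
  have 2: "z \<in> ell2_resolvent_set A" if bb: "bounded_below L" and bij: "bij L"
  proof -
    obtain c where c: "c > 0" "\<And>u. c * norm u \<le> norm (L u)" using bounded_belowE[OF bb] by blast
    \<comment> \<open>Outside \<open>ell2\<close> the value of \<open>Abs_l2\<close> is unspecified;
      the conditions on a resolvent concern arguments in \<open>ell2\<close> only.\<close>
    define R where "R v = l2_fun (inv L (Abs_l2 v))" for v
    have R: "R (l2_fun v) = l2_fun (inv L v)" for v by (simp add: R_def l2_fun_inverse)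
    have inv1: "inv L (L u) = u" for u using bij by (simp add: bij_is_inj)
    have inv2: "L (inv L u) = u" for u using bij by (simp add: bij_is_surj surj_f_inv_f)
    have "inv L (u + v) = inv L u + inv L v" for u v
      using inv1[of "inv L u + inv L v"] by (simp add: L.add inv2)
    moreover have "inv L (l2_scale k u) = l2_scale k (inv L u)" for k u
      using inv1[of "l2_scale k (inv L u)"] by (simp add: Lscale inv2)
    moreover have "norm (inv L u) \<le> 1/c * norm u" for u
      using c(2)[of "inv L u"] c(1) by (simp add: inv2 field_simps)
    ultimately have "bounded_ell2_operator R"
      unfolding bounded_ell2_operator_def ell2_all fun_plus fun_scale R norm_fun
      by (auto simp: l2_fun intro: exI[of _ "1 / c"])
    then show ?thesis
      unfolding ell2_resolvent_set_def mem_Collect_eq ell2_all Lfun R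
      by (intro exI[of _ R]) (auto simp: Lfun R inv1 inv2)
  qed
  show ?thesis
  proof (cases "Im z = 0")
    case True
    then have z: "z = complex_of_real (Re z)" by (simp add: complex_eq_iff)
    have "l2_scale z u = Re z *\<^sub>R u" for u :: "'a l2"
      by (subst z) (rule l2_scale_of_real)
    then have L_eq: "L = (\<lambda>u. T u - Re z *\<^sub>R u)" by (simp add: L_def fun_eq_iff)
    have "bounded_below L \<Longrightarrow> bij L"
      unfolding L_eq by (rule self_adjoint_bij[OF self_adjoint_shift[OF T]])
    then have "z \<in> ell2_resolvent_set A \<longleftrightarrow> bounded_below L" using 1 2 by blast
    then show ?thesis using True by (simp add: ell2_spectrum_def L_eq)
  next
    case False
    define B where "B u = T u - Re z *\<^sub>R u" for u
    define y where "y = Im z"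
    define I :: "'a l2 \<Rightarrow> 'a l2" where "I = l2_scale \<i>"
    have B: "self_adjoint B" unfolding B_def by (rule self_adjoint_shift[OF T])
    interpret B: bounded_linear B using self_adjointD(1)[OF B] .
    interpret I: bounded_linear I unfolding I_def by (rule bounded_linear_l2_mult)
    have BI: "B (I u) = I (B u)" for u
      by (rule l2_eqI) (simp add: B_def I_def scale algebra_simps)
    have II: "I (I u) = - u" for u by (rule l2_eqI) (simp add: I_def)
    have Iadj: "I u \<bullet> v = - (u \<bullet> I v)" for u v
    proof -
      have "l2_scale (- \<i>) v = - I v" by (rule l2_eqI) (simp add: I_def)
      then show ?thesis unfolding I_def by (subst l2_mult_adjoint) auto
    qed
    have LB: "L u = B u - y *\<^sub>R I u" for u
      by (rule l2_eqI) (simp add: L_def B_def I_def y_def complex_eq_iff algebra_simps)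
    \<comment> \<open>\<open>I\<close> is skew for the real inner product and commutes with the
      symmetric \<open>B\<close>, so the pairing equals its own negative.\<close>
    have "I u \<bullet> B u = 0" for u
    proof -
      have "I u \<bullet> B u = B (I u) \<bullet> u" using self_adjointD(2)[OF B, of "I u" u] by simp
      also have "\<dots> = - (B u \<bullet> I u)" by (simp add: BI Iadj)
      finally show ?thesis by (simp add: inner_commute)
    qed
    then have "(norm (L u))\<^sup>2 = (norm (B u))\<^sup>2 + (\<bar>y\<bar> * norm u)\<^sup>2" for u
      unfolding LB norm_diff_scaleR_square by (simp add: I_def norm_l2_scale power_mult_distrib)
    then have "(\<bar>y\<bar> * norm u)\<^sup>2 \<le> (norm (L u))\<^sup>2" for u by simp
    then have "\<bar>y\<bar> * norm u \<le> norm (L u)" for u by (rule power2_le_imp_le) auto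
    then have bb: "bounded_below L"
      unfolding bounded_below_def using False by (intro exI[of _ "\<bar>y\<bar>"]) (auto simp: y_def)
    \<comment> \<open>This is \<open>B\<^sup>2 + y\<^sup>2\<close>, written with the coefficient
      \<open>- y\<^sup>2\<close> to match the form of \<open>self_adjoint_shift\<close>.\<close>
    have "bij (\<lambda>u. B (B u) - (- y\<^sup>2) *\<^sub>R u)"
    proof (rule self_adjoint_bij)
      show "self_adjoint (\<lambda>u. B (B u) - (- y\<^sup>2) *\<^sub>R u)"
        by (intro self_adjoint_shift self_adjoint_square B)
      have "y\<^sup>2 * norm u \<le> norm (B (B u) - (- y\<^sup>2) *\<^sub>R u)" for u
      proof (cases "u = 0")
        case False
        have "y\<^sup>2 * norm u * norm u \<le> (B (B u) - (- y\<^sup>2) *\<^sub>R u) \<bullet> u"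
          by (simp add: inner_add_left self_adjoint_norm_square[OF B] flip: power2_norm_eq_inner)
            (simp add: power2_eq_square)
        also have "\<dots> \<le> norm (B (B u) - (- y\<^sup>2) *\<^sub>R u) * norm u" by (rule norm_cauchy_schwarz)
        finally show ?thesis using False by simp
      qed simp
      then show "bounded_below (\<lambda>u. B (B u) - (- y\<^sup>2) *\<^sub>R u)"
        unfolding bounded_below_def using False by (intro exI[of _ "y\<^sup>2"]) (auto simp: y_def)
    qed
    from surjD[OF bij_is_surj[OF this]]
    have "\<exists>x. v = B (B x) - (- y\<^sup>2) *\<^sub>R x" for v .
    moreover have "L (B x + y *\<^sub>R I x) = B (B x) - (- y\<^sup>2) *\<^sub>R x" for x
      by (simp add: LB B.add B.scaleR I.add I.scaleR BI II power2_eq_square algebra_simps)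
    ultimately have "surj L" unfolding surj_def by metis
    moreover have "inj L"
    proof -
      have "u = v" if "L u = L v" for u v
        using bounded_belowE[OF bb] that
        by (metis L.diff mult_le_0_iff norm_le_zero_iff norm_zero not_less right_minus_eq)
      then show ?thesis by (auto simp: inj_def)
    qed
    ultimately show ?thesis
      using False 2[OF bb] by (auto simp: ell2_spectrum_def bij_def)
  qed
qed

end

section \<open>Weyl's criterion for the essential spectrum\<close>

text \<open>Gaussian elimination with more unknowns than equations: a pivot \<open>k\<close> for the
  equation at \<open>m\<close> is subtracted from the other columns so that they vanish at
  \<open>m\<close>, and its coefficient is recovered afterwards by back substitution.\<close>

lemma exists_nontrivial_relation:
  fixes u :: "'i \<Rightarrow> 'a \<Rightarrow> 'k::field"
  assumes "finite F" "finite I" "card F < card I"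
  shows "\<exists>c. (\<exists>i\<in>I. c i \<noteq> 0) \<and> (\<forall>n\<in>F. (\<Sum>i\<in>I. c i * u i n) = 0)"
  using assms
proof (induction F arbitrary: I u rule: finite_induct)
  case empty
  then have "I \<noteq> {}" by auto
  then show ?case by (intro exI[of _ "\<lambda>_. 1"]) auto
next
  case (insert m F)
  show ?case
  proof (cases "\<forall>i\<in>I. u i m = 0")
    case True
    have "card F < card I" using insert.prems insert.hyps by simp
    from insert.IH[OF insert.prems(1) this, of u] True show ?thesis by auto
  next
    case False
    then obtain k where k: "k \<in> I" "u k m \<noteq> 0" by auto
    define u' where "u' i n = u i n - u i m / u k m * u k n" for i n
    have "card F < card (I - {k})" using insert.prems insert.hyps k(1) by simp
    from insert.IH[OF _ this, of u'] insert.prems(1)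
    obtain c where c: "\<exists>i\<in>I-{k}. c i \<noteq> 0" "\<And>n. n \<in> F \<Longrightarrow> (\<Sum>i\<in>I-{k}. c i * u' i n) = 0"
      by auto
    define s where "s = (\<Sum>i\<in>I-{k}. c i * (u i m / u k m))"
    define d where "d = c(k := - s)"
    have sum_d: "(\<Sum>i\<in>I. d i * u i n) = (\<Sum>i\<in>I-{k}. c i * u' i n)" for n
    proof -
      have "(\<Sum>i\<in>I. d i * u i n) = d k * u k n + (\<Sum>i\<in>I-{k}. d i * u i n)"
        using k(1) insert.prems(1) by (simp add: sum.remove)
      also have "(\<Sum>i\<in>I-{k}. d i * u i n) = (\<Sum>i\<in>I-{k}. c i * u i n)"
        by (intro sum.cong) (auto simp: d_def)
      also have "d k * u k n = - (\<Sum>i\<in>I-{k}. c i * (u i m / u k m) * u k n)"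
        by (simp add: d_def s_def sum_distrib_right)
      finally show ?thesis by (simp add: u'_def sum_subtractf algebra_simps)
    qed
    moreover have "u' i m = 0" for i using k(2) by (simp add: u'_def)
    moreover have "\<exists>i\<in>I. d i \<noteq> 0" using c(1) by (auto simp: d_def)
    ultimately show ?thesis using c(2) by (intro exI[of _ d]) auto
  qed
qed

text \<open>Division by the largest coefficient. The bound 1 on all coefficients controls the errors
  of a linear combination, while the coefficient of modulus 1 keeps the combination from being
  small.\<close>

lemma exists_normalized_relation:
  fixes u :: "'i \<Rightarrow> 'a \<Rightarrow> complex"
  assumes "finite F" "finite I" "card F < card I"
  shows "\<exists>c. (\<exists>k\<in>I. cmod (c k) = 1) \<and> (\<forall>i\<in>I. cmod (c i) \<le> 1) \<and> (\<forall>n\<in>F. (\<Sum>i\<in>I. c i * u i n) = 0)"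
proof -
  obtain c where c: "\<exists>i\<in>I. c i \<noteq> 0" "\<And>n. n \<in> F \<Longrightarrow> (\<Sum>i\<in>I. c i * u i n) = 0"
    using exists_nontrivial_relation[OF assms, of u] by blast
  define M where "M = Max ((\<lambda>i. cmod (c i)) ` I)"
  have "I \<noteq> {}" using c(1) by auto
  then have "M \<in> (\<lambda>i. cmod (c i)) ` I" unfolding M_def using assms(2) by (intro Max_in) auto
  then obtain k where k: "k \<in> I" "M = cmod (c k)" by auto
  have le: "cmod (c i) \<le> M" if "i \<in> I" for i unfolding M_def using assms(2) that by auto
  have "M > 0" using c(1) le by (metis norm_le_zero_iff not_less order_trans)
  define d where "d i = c i / of_real M" for i
  show ?thesis
  proof (intro exI[of _ d] conjI ballI)
    show "\<exists>k\<in>I. cmod (d k) = 1" using k \<open>M > 0\<close> by (intro bexI[of _ k]) (auto simp: d_def norm_divide)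
    show "cmod (d i) \<le> 1" if "i \<in> I" for i
      using le[OF that] \<open>M > 0\<close> by (simp add: d_def norm_divide)
    show "(\<Sum>i\<in>I. d i * u i n) = 0" if "n \<in> F" for n
      using c(2)[OF that] by (simp add: d_def flip: sum_divide_distrib)
  qed
qed

text \<open>Testing against the unit vector \<open>v k\<close> alone suffices, so only the inner
  products with \<open>v k\<close> have to be small, and the other vectors may have any
  norm.\<close>

lemma norm_sum_almost_orthogonal:
  fixes v :: "'i \<Rightarrow> 'a::real_inner" and \<eta> :: real
  assumes "finite I" "k \<in> I" "norm (v k) = 1" "\<eta> \<ge> 0"
    and "\<And>i. i \<in> I \<Longrightarrow> i \<noteq> k \<Longrightarrow> \<bar>v i \<bullet> v k\<bar> \<le> \<eta>"
  shows "1 - card I * \<eta> \<le> norm (\<Sum>i\<in>I. v i)"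
proof -
  have "\<bar>\<Sum>i\<in>I-{k}. v i \<bullet> v k\<bar> \<le> (\<Sum>i\<in>I-{k}. \<eta>)"
    by (rule order_trans[OF sum_abs sum_mono]) (use assms(5) in auto)
  also have "\<dots> \<le> card I * \<eta>"
    using assms(1,4) by (simp add: mult_right_mono card_mono)
  finally have "1 - card I * \<eta> \<le> v k \<bullet> v k + (\<Sum>i\<in>I-{k}. v i \<bullet> v k)"
    using assms(3) by (simp add: norm_eq_1 abs_le_iff)
  also have "\<dots> = (\<Sum>i\<in>I. v i) \<bullet> v k"
    unfolding inner_sum_left using assms(1,2) by (simp add: sum.remove)
  also have "\<dots> \<le> norm (\<Sum>i\<in>I. v i)"
    using norm_cauchy_schwarz[of "\<Sum>i\<in>I. v i" "v k"] assms(3) by simp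
  finally show ?thesis .
qed

lemma l2_truncate_almost_null:
  assumes S: "bounded_linear S" and u: "norm (S u :: 'b::real_normed_vector) < e * norm u" and e: "e > 0"
  obtains F where "finite F" "norm (S (l2_mult (indicator F) u)) < e * norm (l2_mult (indicator F) u)"
proof -
  interpret S: bounded_linear S by (rule S)
  obtain K where K: "K > 0" "\<And>u. norm (S u) \<le> K * norm u"
    using S.pos_bounded by (auto simp: mult.commute)
  \<comment> \<open>The slack in the strict inequality is divided between the error
    \<open>K * d\<close> on the left and the loss \<open>e * d\<close> on the right.\<close>
  define d where "d = (e * norm u - norm (S u)) / (K + e)"
  have d: "d > 0" using u e K(1) by (simp add: d_def)
  then obtain F where F: "finite F" "norm (u - l2_mult (indicator F) u) < d"
    using l2_truncate by blast
  let ?v = "l2_mult (indicator F) u"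
  have "norm (S ?v) \<le> norm (S u) + norm (S (u - ?v))"
    using norm_triangle_ineq4[of "S u" "S (u - ?v)"] by (simp add: S.diff)
  also have "\<dots> < norm (S u) + K * d"
    using order_le_less_trans[OF K(2) mult_strict_left_mono[OF F(2) K(1)]] by simp
  also have "\<dots> = e * norm u - e * d" using K(1) e by (simp add: d_def field_simps)
  also have "\<dots> \<le> e * norm ?v"
  proof -
    have "norm u - d \<le> norm ?v" using F(2) norm_triangle_ineq2[of u ?v] by linarith
    from mult_left_mono[OF this, of e] e show ?thesis by (simp add: algebra_simps)
  qed
  finally show ?thesis using F(1) that by blast
qed

lemma norm_normalized_less:
  assumes S: "bounded_linear S" and u: "norm (S u :: 'b::real_normed_vector) < e * norm u"
  shows "norm (inverse (norm u) *\<^sub>R u) = 1" "norm (S (inverse (norm u) *\<^sub>R u)) < e"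
proof -
  interpret S: bounded_linear S by (rule S)
  have "u \<noteq> 0" using u by auto
  then show "norm (inverse (norm u) *\<^sub>R u) = 1" by simp
  have "norm (S (inverse (norm u) *\<^sub>R u)) = norm (S u) / norm u"
    by (simp add: S.scaleR divide_inverse)
  then show "norm (S (inverse (norm u) *\<^sub>R u)) < e"
    using u \<open>u \<noteq> 0\<close> by (simp add: pos_divide_less_eq)
qed

text \<open>A singular Weyl sequence in which weak convergence to 0 is replaced by vanishing on
  prescribed finite sets. Strictness of the inequality forces \<open>v\<close> to be
  nonzero.\<close>

definition weyl_at_infinity :: "('a l2 \<Rightarrow> 'a l2) \<Rightarrow> real \<Rightarrow> bool" where
  "weyl_at_infinity T x \<longleftrightarrow>
     (\<forall>e>0. \<forall>F. finite F \<longrightarrow> (\<exists>v. (\<forall>n\<in>F. l2_fun v n = 0) \<and> norm (T v - x *\<^sub>R v) < e * norm v))"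

lemma sum_fun_apply: "(\<Sum>i\<in>I. f i) x = (\<Sum>i\<in>I. f i x)"
  by (induction I rule: infinite_finite_induct) auto

context ell2_self_adjoint
begin

text \<open>The supports found so far have a finite union \<open>F\<close>, off which the criterion
  supplies another vector; truncating it makes its support finite without leaving the complement of
  \<open>F\<close>, so the induction continues.\<close>

lemma weyl_at_infinity_disjoint_supports:
  fixes N :: nat
  assumes W: "weyl_at_infinity T x" and e: "e > 0"
  shows "\<exists>v. \<forall>i<N. norm (v i) = 1 \<and> norm (T (v i) - x *\<^sub>R v i) < e \<and> finite {n. l2_fun (v i) n \<noteq> 0} \<and>
           (\<forall>j<i. \<forall>n. l2_fun (v i) n = 0 \<or> l2_fun (v j) n = 0)"
proof (induction N)
  case (Suc N)
  then obtain v where v: "\<And>i. i < N \<Longrightarrow> norm (v i) = 1 \<and> norm (T (v i) - x *\<^sub>R v i) < e \<and>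
      finite {n. l2_fun (v i) n \<noteq> 0} \<and> (\<forall>j<i. \<forall>n. l2_fun (v i) n = 0 \<or> l2_fun (v j) n = 0)" by blast
  define F where "F = (\<Union>i<N. {n. l2_fun (v i) n \<noteq> 0})"
  have "finite F" using v by (auto simp: F_def)
  then obtain u where u: "\<And>n. n \<in> F \<Longrightarrow> l2_fun u n = 0" "norm (T u - x *\<^sub>R u) < e * norm u"
    using W e unfolding weyl_at_infinity_def by blast
  have S: "bounded_linear (\<lambda>u. T u - x *\<^sub>R u)"
    using self_adjointD(1)[OF self_adjoint_shift[OF T]] .
  from l2_truncate_almost_null[OF S u(2) e] obtain G
    where G: "finite G" and G_less: "norm (T (l2_mult (indicator G) u) - x *\<^sub>R l2_mult (indicator G) u)
      < e * norm (l2_mult (indicator G) u)" .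
  define w where "w = l2_mult (indicator G) u"
  have w: "norm (T w - x *\<^sub>R w) < e * norm w" using G_less by (simp add: w_def)
  have w_fun: "l2_fun w n = indicator G n * l2_fun u n" for n
    by (simp add: w_def bounded_range_indicator)
  define w' where "w' = inverse (norm w) *\<^sub>R w"
  have w'_fun: "l2_fun w' n = of_real (inverse (norm w)) * l2_fun w n" for n
    by (simp add: w'_def)
  have 1: "norm w' = 1" and 2: "norm (T w' - x *\<^sub>R w') < e"
    using norm_normalized_less[OF S w] by (simp_all add: w'_def)
  have 3: "finite {n. l2_fun w' n \<noteq> 0}"
    by (rule finite_subset[OF _ G]) (auto simp: w'_fun w_fun indicator_def)
  have 4: "l2_fun w' n = 0 \<or> l2_fun (v j) n = 0" if "j < N" for j n
    using u(1)[of n] that by (auto simp: w'_fun w_fun F_def)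
  show ?case
  proof (intro exI[of _ "v(N := w')"] allI impI)
    fix i assume "i < Suc N"
    then show "norm ((v(N := w')) i) = 1 \<and> norm (T ((v(N := w')) i) - x *\<^sub>R (v(N := w')) i) < e \<and>
        finite {n. l2_fun ((v(N := w')) i) n \<noteq> 0} \<and>
        (\<forall>j<i. \<forall>n. l2_fun ((v(N := w')) i) n = 0 \<or> l2_fun ((v(N := w')) j) n = 0)"
      using v[of i] 1 2 3 4 by (cases "i = N") auto
  qed
qed auto

lemma spectrum_of_real_iff:
  "complex_of_real x \<in> ell2_spectrum A \<longleftrightarrow> \<not> bounded_below (\<lambda>u. T u - x *\<^sub>R u)"
  by (simp add: ell2_spectrum_iff)

lemma eigenspace_iff:
  "l2_fun u \<in> ell2_eigenspace A (complex_of_real x) \<longleftrightarrow> T u - x *\<^sub>R u = 0"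
proof -
  have "cscale (complex_of_real x) (l2_fun u) = l2_fun (x *\<^sub>R u)"
    by (auto simp: cscale_def)
  then show ?thesis by (simp add: ell2_eigenspace_def l2_fun A l2_fun_inject)
qed

text \<open>Isolation provides the lower bounds at all nearby points that
  \<open>self_adjoint_near_kernel\<close> requires. The conclusion is all that is used about
  isolated points of the spectrum: a small residual means a nearby solution of the eigenvalue
  equation.\<close>

lemma isolated_spectrum_gap:
  assumes "complex_of_real x isolated_in ell2_spectrum A"
  obtains \<delta> where "\<delta> > 0"
    "\<And>u. \<exists>p. T p - x *\<^sub>R p = 0 \<and> \<delta> * norm (u - p) \<le> norm (T u - x *\<^sub>R u)"
proof -
  obtain \<delta> where \<delta>: "\<delta> > 0" "\<And>y. y \<in> ell2_spectrum A \<Longrightarrow> dist (complex_of_real x) y < \<delta> \<Longrightarrow> y = complex_of_real x"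
    using assms unfolding isolated_in_dist_Ex_iff by blast
  have gap: "bounded_below (\<lambda>u. T u - x *\<^sub>R u - d *\<^sub>R u)" if d: "0 < \<bar>d\<bar>" "\<bar>d\<bar> < \<delta>" for d
  proof -
    have "dist (complex_of_real x) (complex_of_real (x + d)) < \<delta>"
      using d by (simp add: dist_norm)
    then have "complex_of_real (x + d) \<notin> ell2_spectrum A"
      using \<delta>(2)[of "complex_of_real (x + d)"] d by auto
    then have "bounded_below (\<lambda>u. T u - (x + d) *\<^sub>R u)" by (subst (asm) spectrum_of_real_iff) simp
    then show ?thesis by (simp add: algebra_simps)
  qed
  show ?thesis
    using self_adjoint_near_kernel[OF self_adjoint_shift[OF T] \<delta>(1) gap] \<delta>(1)
    by (intro that[of \<delta>]) metis+
qed

text \<open>At an isolated eigenvalue of finite multiplicity, each of \<open>N\<close> disjointly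
  supported unit vectors \<open>v i\<close> is close to some \<open>p i\<close> in the eigenspace.
  As \<open>N\<close> exceeds the size of a spanning set, the \<open>p i\<close> satisfy a
  normalized linear relation. The same combination of the \<open>v i\<close> has norm at least 1 by
  orthogonality, but at most 1/2 by closeness.\<close>

lemma essential_spectrumI:
  assumes W: "weyl_at_infinity T x"
  shows "complex_of_real x \<in> ell2_essential_spectrum A"
proof -
  have "complex_of_real x \<in> ell2_spectrum A"
    unfolding spectrum_of_real_iff
  proof
    assume "bounded_below (\<lambda>u. T u - x *\<^sub>R u)"
    then obtain c where c: "c > 0" "\<And>u. c * norm u \<le> norm (T u - x *\<^sub>R u)" using bounded_belowE by blast
    then obtain v where "norm (T v - x *\<^sub>R v) < c * norm v"
      using W unfolding weyl_at_infinity_def by (metis finite.emptyI)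
    with c(2)[of v] show False by simp
  qed
  moreover have "complex_of_real x \<notin> ell2_discrete_spectrum A"
  proof
    assume "complex_of_real x \<in> ell2_discrete_spectrum A"
    then obtain D where isol: "complex_of_real x isolated_in ell2_spectrum A"
      and D: "finite D" "ell2_eigenspace A (complex_of_real x) \<subseteq> cfun.span D"
      unfolding ell2_discrete_spectrum_def by blast
    obtain \<delta> where \<delta>: "\<delta> > 0"
      "\<And>u. \<exists>p. T p - x *\<^sub>R p = 0 \<and> \<delta> * norm (u - p) \<le> norm (T u - x *\<^sub>R u)"
      using isolated_spectrum_gap[OF isol] by blast
    define N where "N = Suc (card D)"
    \<comment> \<open>Each \<open>v i\<close> is then within
      \<open>e / \<delta> = 1 / (2 * N)\<close> of \<open>p i\<close>, and the \<open>N\<close>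
      errors add up to at most 1/2.\<close>
    define e where "e = \<delta> / (2 * N)"
    have e: "e > 0" using \<delta>(1) by (simp add: e_def N_def)
    obtain v where v: "\<And>i. i < N \<Longrightarrow> norm (v i) = 1" "\<And>i. i < N \<Longrightarrow> norm (T (v i) - x *\<^sub>R v i) < e"
      "\<And>i j n. i < N \<Longrightarrow> j < i \<Longrightarrow> l2_fun (v i) n = 0 \<or> l2_fun (v j) n = 0"
      using weyl_at_infinity_disjoint_supports[OF W e, of N] by blast
    obtain p where p: "\<And>i. T (p i) - x *\<^sub>R p i = 0"
      "\<And>i. \<delta> * norm (v i - p i) \<le> norm (T (v i) - x *\<^sub>R v i)"
      using \<delta>(2)[of "v _"] by metis
    have "l2_fun (p i) \<in> ell2_eigenspace A (complex_of_real x)" for i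
      using p(1) by (simp add: eigenspace_iff)
    then have "l2_fun (p i) \<in> cfun.span D" for i using D(2) by blast
    then have "\<exists>r. l2_fun (p i) = (\<Sum>b\<in>D. cscale (r b) b)" for i
      unfolding cfun.span_finite[OF D(1)] by auto
    then obtain r where r: "\<And>i. l2_fun (p i) = (\<Sum>b\<in>D. cscale (r i b) b)" by metis
    obtain c k where c: "k < N" "cmod (c k) = 1" "\<And>i. i < N \<Longrightarrow> cmod (c i) \<le> 1"
      "\<And>b. b \<in> D \<Longrightarrow> (\<Sum>i<N. c i * r i b) = 0"
      using exists_normalized_relation[OF D(1) finite_lessThan[of N], of r]
      unfolding card_lessThan N_def by blast
    have p0: "(\<Sum>i<N. l2_scale (c i) (p i)) = 0"
    proof (rule l2_eqI)
      fix n
      have "l2_fun (\<Sum>i<N. l2_scale (c i) (p i)) n = (\<Sum>i<N. \<Sum>b\<in>D. c i * r i b * b n)"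
        by (simp add: r sum_fun_apply cscale_def sum_distrib_left mult.assoc)
      also have "\<dots> = (\<Sum>b\<in>D. (\<Sum>i<N. c i * r i b) * b n)"
        by (subst sum.swap) (simp add: sum_distrib_right)
      also have "\<dots> = 0" by (simp add: c(4))
      finally show "l2_fun (\<Sum>i<N. l2_scale (c i) (p i)) n = l2_fun 0 n" by simp
    qed
    have "1 - real (card {..<N}) * 0 \<le> norm (\<Sum>i\<in>{..<N}. l2_scale (c i) (v i))"
    proof (rule norm_sum_almost_orthogonal)
      show "norm (l2_scale (c k) (v k)) = 1" using c v by (simp add: norm_l2_scale)
      fix i assume i: "i \<in> {..<N}" "i \<noteq> k"
      have dis: "l2_fun (v i) n = 0 \<or> l2_fun (v k) n = 0" for n
        using v(3)[of i k n] v(3)[of k i n] i c(1) by (cases "i < k") auto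
      have "l2_fun (l2_scale (c i) (v i)) n \<bullet> l2_fun (l2_scale (c k) (v k)) n = 0" for n
        using dis[of n] by auto
      then show "\<bar>l2_scale (c i) (v i) \<bullet> l2_scale (c k) (v k)\<bar> \<le> 0"
        unfolding l2_inner_eq by simp
    qed (use c in auto)
    also have "(\<Sum>i\<in>{..<N}. l2_scale (c i) (v i)) = (\<Sum>i<N. l2_scale (c i) (v i - p i))"
      using p0 by (simp add: linear_diff[OF bounded_linear.linear[OF bounded_linear_l2_mult]] sum_subtractf)
    also have "norm \<dots> \<le> (\<Sum>i<N. 1 / (2 * N))"
    proof (rule sum_norm_le)
      fix i assume i: "i \<in> {..<N}"
      have "norm (l2_scale (c i) (v i - p i)) \<le> norm (v i - p i)"
        using c(3) i by (simp add: norm_l2_scale mult_left_le_one_le)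
      also have "\<dots> \<le> e / \<delta>"
        using order_trans[OF p(2) less_imp_le[OF v(2)], of i] i \<delta>(1) by (simp add: field_simps)
      also have "\<dots> = 1 / (2 * N)" using \<delta>(1) by (simp add: e_def)
      finally show "norm (l2_scale (c i) (v i - p i)) \<le> 1 / (2 * N)" .
    qed
    also have "\<dots> = 1/2" by (simp add: N_def)
    finally show False by simp
  qed
  ultimately show ?thesis by (simp add: ell2_essential_spectrum_def)
qed

text \<open>Vanishing on \<open>F\<close> imposes \<open>card F\<close> linear conditions, so
  \<open>N = card F + 1\<close> vectors suffice. If \<open>x\<close> is isolated, they are taken
  independent in the eigenspace, which has infinite dimension. Otherwise they are approximate
  eigenvectors for \<open>N\<close> distinct spectral points close to \<open>x\<close>; these are
  almost orthogonal, so a normalized combination stays large.\<close>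

lemma essential_spectrumD:
  assumes z: "complex_of_real x \<in> ell2_essential_spectrum A"
  shows "weyl_at_infinity T x"
  unfolding weyl_at_infinity_def
proof (intro allI impI)
  fix e :: real and F :: "'a set" assume e: "e > 0" and F: "finite F"
  have spec: "complex_of_real x \<in> ell2_spectrum A"
    and ndisc: "complex_of_real x \<notin> ell2_discrete_spectrum A"
    using z by (auto simp: ell2_essential_spectrum_def)
  define N where "N = Suc (card F)"
  show "\<exists>v. (\<forall>n\<in>F. l2_fun v n = 0) \<and> norm (T v - x *\<^sub>R v) < e * norm v"
  proof (cases "complex_of_real x isolated_in ell2_spectrum A")
    case True
    define E where "E = ell2_eigenspace A (complex_of_real x)"
    obtain \<delta> where \<delta>: "\<delta> > 0"
      "\<And>u. \<exists>p. T p - x *\<^sub>R p = 0 \<and> \<delta> * norm (u - p) \<le> norm (T u - x *\<^sub>R u)"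
      using isolated_spectrum_gap[OF True] by blast
    have "E \<noteq> {0}"
    proof
      assume E0: "E = {0}"
      have "p = 0" if "T p - x *\<^sub>R p = 0" for p
      proof -
        have "l2_fun p \<in> E" using that by (simp add: E_def eigenspace_iff)
        then have "l2_fun p = 0" using E0 by simp
        then show ?thesis by (intro l2_eqI) simp
      qed
      then have "bounded_below (\<lambda>u. T u - x *\<^sub>R u)"
        unfolding bounded_below_def using \<delta> by (metis diff_zero)
      then show False using spec by (simp add: spectrum_of_real_iff)
    qed
    obtain B where B: "B \<subseteq> E" "cfun.independent B" "E \<subseteq> cfun.span B"
      using cfun.maximal_independent_subset[of E] by blast
    have "infinite B"
      using ndisc True \<open>E \<noteq> {0}\<close> B(3) unfolding ell2_discrete_spectrum_def E_def by blast
    then obtain C where C: "finite C" "card C = N" "C \<subseteq> B"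
      using infinite_arbitrarily_large by blast
    have Cind: "cfun.independent C" using B(2) C(3) cfun.independent_mono by blast
    have card: "card F < card C" by (simp add: C(2) N_def)
    obtain c k where c: "k \<in> C" "cmod (c k) = 1" "\<And>n. n \<in> F \<Longrightarrow> (\<Sum>u\<in>C. c u * u n) = 0"
      using exists_normalized_relation[OF F C(1) card, of "\<lambda>u. u"] by blast
    define v where "v = (\<Sum>u\<in>C. l2_scale (c u) (Abs_l2 u))"
    have CE: "u \<in> ell2" "u \<in> E" if "u \<in> C" for u
      using that C(3) B(1) by (auto simp: E_def ell2_eigenspace_def)
    have v_fun: "l2_fun v n = (\<Sum>u\<in>C. c u * u n)" for n
      unfolding v_def l2_fun_sum by (intro sum.cong) (auto simp: CE Abs_l2_inverse)
    have "v \<noteq> 0"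
    proof
      assume "v = 0"
      then have "(\<Sum>u\<in>C. c u * u n) = 0" for n using v_fun[of n] by simp
      then have "(\<Sum>u\<in>C. cscale (c u) u) = 0"
        by (auto simp: sum_fun_apply cscale_def fun_eq_iff)
      then have "cfun.dependent C"
        using c(1,2) C(1) by (subst cfun.dependent_finite) (auto intro!: exI[of _ c] bexI[of _ k])
      then show False using Cind by simp
    qed
    moreover have "T v - x *\<^sub>R v = 0"
    proof -
      have "T (Abs_l2 u) = x *\<^sub>R Abs_l2 u" if "u \<in> C" for u
        using eigenspace_iff[of "Abs_l2 u" x] CE[OF that] by (simp add: Abs_l2_inverse E_def)
      then have "T (l2_scale (c u) (Abs_l2 u)) = x *\<^sub>R l2_scale (c u) (Abs_l2 u)" if "u \<in> C" for u
        by (simp add: scale that) (rule l2_eqI; simp)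
      then show ?thesis by (simp add: v_def T.sum scaleR_sum_right)
    qed
    ultimately show ?thesis
      using c(3) e by (intro exI[of _ v]) (auto simp: v_fun)
  next
    case False
    then have "complex_of_real x islimpt ell2_spectrum A"
      using spec by (simp add: isolated_in_islimpt_iff)
    \<comment> \<open>Each of the \<open>N\<close> terms will have residual at most
      \<open>2 * d\<close> at \<open>x\<close>, in total \<open>e / 4\<close>, against a norm of at
      least 1/2.\<close>
    define d where "d = e / (8 * N)"
    have d: "d > 0" using e by (simp add: d_def N_def)
    have "infinite (ell2_spectrum A \<inter> ball (complex_of_real x) d)"
      using \<open>_ islimpt _\<close> d by (simp add: islimpt_eq_infinite_ball)
    then obtain I where I: "finite I" "card I = N" "I \<subseteq> ell2_spectrum A \<inter> ball (complex_of_real x) d"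
      using infinite_arbitrarily_large by blast
    have real: "w = complex_of_real (Re w)" "\<not> bounded_below (\<lambda>u. T u - Re w *\<^sub>R u)" if "w \<in> I" for w
      using I(3) that ell2_spectrum_iff[of w] by (auto simp: complex_eq_iff)
    have near: "\<bar>Re w - x\<bar> < d" if "w \<in> I" for w
    proof -
      have "dist (complex_of_real x) w < d" using I(3) that by auto
      then show ?thesis
        by (subst (asm) real(1)[OF that]) (simp add: dist_norm abs_minus_commute flip: of_real_diff)
    qed
    \<comment> \<open>The least distance between the chosen spectral points; the inserted 1 covers
      the case of a single point, which occurs for empty \<open>F\<close>.\<close>
    define \<gamma> where "\<gamma> = Min (insert 1 ((\<lambda>(w, w'). \<bar>Re w - Re w'\<bar>) ` {(w, w') \<in> I \<times> I. w \<noteq> w'}))"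
    have fin: "finite ((\<lambda>(w, w'). \<bar>Re w - Re w'\<bar>) ` {(w, w') \<in> I \<times> I. w \<noteq> w'})"
      by (intro finite_imageI finite_subset[OF _ finite_cartesian_product[OF I(1) I(1)]]) auto
    have \<gamma>: "\<gamma> > 0" unfolding \<gamma>_def using fin real(1)
      by (subst Min_gr_iff) (auto, metis)
    have \<gamma>_le: "\<gamma> \<le> \<bar>Re w - Re w'\<bar>" if "w \<in> I" "w' \<in> I" "w \<noteq> w'" for w w'
      unfolding \<gamma>_def using that fin by (intro Min_le) (auto intro!: image_eqI[of _ _ "(w, w')"])
    \<comment> \<open>The bound \<open>d\<close> limits the residuals; the bound
      \<open>\<gamma> / (4 * N)\<close> brings the inner products, at most
      \<open>2 * \<eta> / \<gamma>\<close>, down to \<open>1 / (2 * N)\<close>.\<close>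
    define \<eta> where "\<eta> = min d (\<gamma> / (4 * N))"
    have \<eta>: "\<eta> > 0" "\<eta> \<le> d" "\<eta> \<le> \<gamma> / (4 * N)"
      using d \<gamma> by (auto simp: \<eta>_def N_def)
    have "\<exists>u. norm u = 1 \<and> norm (T u - Re w *\<^sub>R u) \<le> \<eta>" if w: "w \<in> I" for w
    proof -
      obtain u where u: "norm (T u - Re w *\<^sub>R u) < \<eta> * norm u"
        using not_bounded_belowE[OF real(2)[OF w] \<eta>(1)] .
      have "bounded_linear (\<lambda>u. T u - Re w *\<^sub>R u)"
        using self_adjointD(1)[OF self_adjoint_shift[OF T]] .
      from norm_normalized_less[OF this u] show ?thesis by (meson less_imp_le)
    qed
    then obtain u where u: "\<And>w. w \<in> I \<Longrightarrow> norm (u w) = 1"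
      "\<And>w. w \<in> I \<Longrightarrow> norm (T (u w) - Re w *\<^sub>R u w) \<le> \<eta>" by metis
    obtain c k where c: "k \<in> I" "cmod (c k) = 1" "\<And>w. w \<in> I \<Longrightarrow> cmod (c w) \<le> 1"
      "\<And>n. n \<in> F \<Longrightarrow> (\<Sum>w\<in>I. c w * l2_fun (u w) n) = 0"
      using exists_normalized_relation[OF F I(1), of "\<lambda>w. l2_fun (u w)"]
      unfolding I(2) N_def by blast
    define v where "v w = l2_scale (c w) (u w)" for w
    have v_le: "norm (v w) \<le> 1" if "w \<in> I" for w
      using c(3)[OF that] u(1)[OF that] by (simp add: v_def norm_l2_scale)
    have v_approx: "norm (T (v w) - Re w *\<^sub>R v w) \<le> \<eta>" if "w \<in> I" for w
    proof -
      have "T (v w) - Re w *\<^sub>R v w = l2_scale (c w) (T (u w) - Re w *\<^sub>R u w)"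
        by (rule l2_eqI) (simp add: v_def scale algebra_simps)
      then have "norm (T (v w) - Re w *\<^sub>R v w) = cmod (c w) * norm (T (u w) - Re w *\<^sub>R u w)"
        by (simp add: norm_l2_scale)
      also have "\<dots> \<le> 1 * \<eta>" using c(3) u(2) that by (intro mult_mono) auto
      finally show ?thesis by simp
    qed
    have "1 - card I * (1 / (2 * N)) \<le> norm (\<Sum>w\<in>I. v w)"
    proof (rule norm_sum_almost_orthogonal[OF I(1) c(1)])
      show "norm (v k) = 1" using c u by (simp add: v_def norm_l2_scale)
      fix w assume w: "w \<in> I" "w \<noteq> k"
      \<comment> \<open>The approximate form of the orthogonality of eigenvectors for distinct
        eigenvalues: by symmetry the two terms with \<open>T\<close> cancel.\<close>
      have "(Re w - Re k) * (v w \<bullet> v k)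
          = v w \<bullet> (T (v k) - Re k *\<^sub>R v k) - (T (v w) - Re w *\<^sub>R v w) \<bullet> v k"
        by (simp add: inner_diff_left inner_diff_right self_adjointD(2)[OF T] algebra_simps)
      also have "\<bar>\<dots>\<bar> \<le> 1 * \<eta> + \<eta> * 1"
      proof (intro order_trans[OF abs_triangle_ineq4] add_mono)
        show "\<bar>v w \<bullet> (T (v k) - Re k *\<^sub>R v k)\<bar> \<le> 1 * \<eta>"
          using v_le[OF w(1)] v_approx[OF c(1)]
          by (intro order_trans[OF Cauchy_Schwarz_ineq2 mult_mono]) auto
        show "\<bar>(T (v w) - Re w *\<^sub>R v w) \<bullet> v k\<bar> \<le> \<eta> * 1"
          using v_le[OF c(1)] v_approx[OF w(1)] \<eta>(1)
          by (intro order_trans[OF Cauchy_Schwarz_ineq2 mult_mono]) auto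
      qed
      finally have "\<bar>Re w - Re k\<bar> * \<bar>v w \<bullet> v k\<bar> \<le> 2 * \<eta>" by (simp add: abs_mult)
      moreover have "\<gamma> * \<bar>v w \<bullet> v k\<bar> \<le> \<bar>Re w - Re k\<bar> * \<bar>v w \<bullet> v k\<bar>"
        using \<gamma>_le[OF w(1) c(1) w(2)] by (intro mult_right_mono) auto
      ultimately have "\<bar>v w \<bullet> v k\<bar> \<le> 2 * \<eta> / \<gamma>" using \<gamma> by (simp add: field_simps)
      also have "\<dots> \<le> 1 / (2 * N)" using \<eta>(3) \<gamma> by (simp add: field_simps N_def)
      finally show "\<bar>v w \<bullet> v k\<bar> \<le> 1 / (2 * N)" .
    qed simp
    moreover have "card I * (1 / (2 * N)) = 1/2" by (simp add: I(2) N_def field_simps)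
    ultimately have big: "1/2 \<le> norm (\<Sum>w\<in>I. v w)" by linarith
    have "T (\<Sum>w\<in>I. v w) - x *\<^sub>R (\<Sum>w\<in>I. v w) = (\<Sum>w\<in>I. T (v w) - x *\<^sub>R v w)"
      by (simp add: T.sum scaleR_sum_right sum_subtractf)
    also have "norm \<dots> \<le> (\<Sum>w\<in>I. d + d)"
    proof (rule sum_norm_le)
      fix w assume w: "w \<in> I"
      have "T (v w) - x *\<^sub>R v w = (T (v w) - Re w *\<^sub>R v w) + (Re w - x) *\<^sub>R v w"
        by (simp add: algebra_simps)
      also have "norm \<dots> \<le> d + d * 1"
      proof (intro order_trans[OF norm_triangle_ineq add_mono])
        show "norm ((Re w - x) *\<^sub>R v w) \<le> d * 1"
          unfolding norm_scaleR using near[OF w] v_le[OF w] d by (intro mult_mono) auto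
      qed (use v_approx[OF w] \<eta>(2) in linarith)
      finally show "norm (T (v w) - x *\<^sub>R v w) \<le> d + d" by simp
    qed
    also have "\<dots> = e / 4"
    proof -
      have "N > 0" by (simp add: N_def)
      then have "real N * d = e / 8" by (simp add: d_def)
      then show ?thesis by (simp add: I(2) distrib_left flip: mult_2)
    qed
    also have "\<dots> < e * norm (\<Sum>w\<in>I. v w)"
      using mult_left_mono[OF big, of e] e by simp
    finally show ?thesis
      using c(4) by (intro exI[of _ "\<Sum>w\<in>I. v w"]) (auto simp: v_def)
  qed
qed

lemma essential_spectrum_iff:
  "z \<in> ell2_essential_spectrum A \<longleftrightarrow> Im z = 0 \<and> weyl_at_infinity T (Re z)"
proof -
  have "Im z = 0" if "z \<in> ell2_essential_spectrum A"
    using that ell2_spectrum_iff by (auto simp: ell2_essential_spectrum_def)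
  moreover have "z = complex_of_real (Re z)" if "Im z = 0"
    using that by (simp add: complex_eq_iff)
  ultimately show ?thesis using essential_spectrumI essential_spectrumD by metis
qed

end

section \<open>Localization of Jacobi matrices\<close>

lemma has_sum_sum:
  fixes f :: "'i \<Rightarrow> 'a \<Rightarrow> 'b::topological_comm_monoid_add"
  assumes "\<And>i. i \<in> I \<Longrightarrow> (f i has_sum S i) A"
  shows "((\<lambda>x. \<Sum>i\<in>I. f i x) has_sum (\<Sum>i\<in>I. S i)) A"
  using assms by (induction I rule: infinite_finite_induct) (auto intro: has_sum_add)

text \<open>Rewriting the sum over \<open>y + R\<close> as a finite sum over \<open>R\<close>
  confines the dependence on \<open>y\<close> to a shift, so that a later summation over
  \<open>y\<close> gives a full sum for each element of \<open>R\<close>.\<close>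

lemma has_sum_indicator_translate:
  fixes f :: "'a::ab_group_add \<Rightarrow> real"
  assumes "finite R"
  shows "((\<lambda>n. indicator R (n - y) * f n) has_sum (\<Sum>q\<in>R. f (y + q))) UNIV"
proof -
  have "((\<lambda>q. indicator R q * f (y + q)) has_sum (\<Sum>q\<in>R. f (y + q))) UNIV
      \<longleftrightarrow> ((\<lambda>q. f (y + q)) has_sum (\<Sum>q\<in>R. f (y + q))) R"
    by (rule has_sum_cong_neutral) auto
  then have "((\<lambda>q. indicator R q * f (y + q)) has_sum (\<Sum>q\<in>R. f (y + q))) UNIV"
    using assms by simp
  moreover have "bij (\<lambda>n. n - y)"
    using bij_plus_right[of "- y"] by simp
  ultimately show ?thesis
    using has_sum_reindex_bij_betw[of "\<lambda>n. n - y" UNIV UNIV "\<lambda>q. indicator R q * f (y + q)"] by simp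
qed

text \<open>Tychonoff's theorem for the closures of the ranges; for a countable index type the
  compact product is also sequentially compact, which replaces a diagonal argument.\<close>

lemma bounded_pointwise_convergent_subseq:
  fixes f :: "nat \<Rightarrow> 'i::countable \<Rightarrow> 'b::heine_borel"
  assumes "\<And>i. bounded (range (\<lambda>j. f j i))"
  obtains r l where "strict_mono r" "\<And>i. (\<lambda>j. f (r j) i) \<longlonglongrightarrow> l i"
proof -
  define S where "S i = closure (range (\<lambda>j. f j i))" for i
  have "compact (S i)" for i using assms by (simp add: S_def compact_closure)
  then have "compact (PiE UNIV S)"
    by (simp add: compactin_PiE flip: compactin_euclidean_iff euclidean_product_topology)
  then have "seq_compact (PiE UNIV S)" by (rule compact_imp_seq_compact)
  moreover have "f j \<in> PiE UNIV S" for j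
    using closure_subset by (fastforce simp: S_def)
  ultimately obtain l r where "strict_mono r" "(f \<circ> r) \<longlonglongrightarrow> l"
    unfolding seq_compact_def by blast
  then show ?thesis
    using that[of r l] continuous_on_tendsto_compose[OF continuous_on_product_coordinates, of "f \<circ> r" l]
    by (simp add: o_def)
qed

section \<open>Boxes whose boundary is small compared to their volume\<close>

definition lattice_box :: "int \<Rightarrow> int \<Rightarrow> (int ^ 'n) set" where
  "lattice_box lo hi = {n. \<forall>i. lo \<le> n $ i \<and> n $ i < hi}"

lemma lattice_box_mono: "lo' \<le> lo \<Longrightarrow> hi \<le> hi' \<Longrightarrow> lattice_box lo hi \<subseteq> lattice_box lo' hi'"
  unfolding lattice_box_def by (auto intro: order_trans less_le_trans)

lemma lattice_box_bij: "bij_betw vec_nth (lattice_box lo hi :: (int ^ 'n) set) (PiE UNIV (\<lambda>_. {lo..<hi}))"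
  by (rule bij_betw_byWitness[of _ "\<lambda>f. \<chi> i. f i"]) (auto simp: lattice_box_def)

lemma finite_lattice_box: "finite (lattice_box lo hi)"
  using bij_betw_finite[OF lattice_box_bij] by (simp add: finite_PiE)

lemma card_lattice_box: "card (lattice_box lo hi :: (int ^ 'n) set) = nat (hi - lo) ^ CARD('n)"
  using bij_betw_same_card[OF lattice_box_bij] by (simp add: card_PiE)

lemma bond_component_le:
  assumes "is_bond e 0"
  shows "\<bar>e $ i\<bar> \<le> 1"
proof -
  have "\<bar>real_of_int (e $ i)\<bar> \<le> 1"
    using component_le_norm_cart[of "\<chi> i. real_of_int (e $ i)" i] assms
    by (simp add: is_bond_def lattice_norm_def)
  then show ?thesis by linarith
qed

lemma finite_lattice_norm_le: "finite {n :: int ^ 'n. lattice_norm n \<le> r}"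
proof (rule finite_subset[OF _ finite_lattice_box[of "- \<lceil>r\<rceil>" "\<lceil>r\<rceil> + 1"]])
  have "- \<lceil>r\<rceil> \<le> n $ i \<and> n $ i < \<lceil>r\<rceil> + 1" if "lattice_norm n \<le> r" for n :: "int ^ 'n" and i
  proof -
    have "\<bar>real_of_int (n $ i)\<bar> \<le> r"
      using component_le_norm_cart[of "\<chi> i. real_of_int (n $ i)" i] that
      by (simp add: lattice_norm_def)
    then show ?thesis by linarith
  qed
  then show "{n :: int ^ 'n. lattice_norm n \<le> r} \<subseteq> lattice_box (- \<lceil>r\<rceil>) (\<lceil>r\<rceil> + 1)"
    by (auto simp: lattice_box_def)
qed

text \<open>The Folner property of the lattice. A bond direction changes each coordinate by at most
  1, so membership in a cube of side \<open>L\<close> can only change between the concentric cubes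
  of sides \<open>L + 2\<close> and \<open>L - 2\<close>, whose difference in volume is negligible
  relative to that of the cube as \<open>L\<close> grows.\<close>

lemma exists_almost_invariant_box:
  fixes \<theta> :: real
  assumes "\<theta> > 0"
  obtains Q :: "(int ^ 'n) set" where "finite Q" "Q \<noteq> {}"
    "\<And>e. is_bond e 0 \<Longrightarrow> finite {m. (m + e \<in> Q) \<noteq> (m \<in> Q)}"
    "\<And>e. is_bond e 0 \<Longrightarrow> card {m. (m + e \<in> Q) \<noteq> (m \<in> Q)} \<le> \<theta> * card Q"
proof -
  let ?d = "CARD('n)"
  have "(\<lambda>L. (1 + 2 / real L) ^ ?d - (1 - 2 / real L) ^ ?d) \<longlonglongrightarrow> (1 + 0) ^ ?d - (1 - 0) ^ ?d"
    by (intro tendsto_intros lim_const_over_n)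
  then have "\<forall>\<^sub>F L in sequentially. (1 + 2 / real L) ^ ?d - (1 - 2 / real L) ^ ?d < \<theta>"
    using assms by (intro order_tendstoD(2)) auto
  \<comment> \<open>\<open>L \<ge> 2\<close> keeps the inner side \<open>L - 2\<close> nonnegative,
    so that \<open>nat\<close> does not truncate it in the cardinality.\<close>
  then have "\<forall>\<^sub>F L in sequentially. L \<ge> 2 \<and> (1 + 2 / real L) ^ ?d - (1 - 2 / real L) ^ ?d < \<theta>"
    using eventually_ge_at_top[of 2] by eventually_elim auto
  then obtain L :: nat where L: "L \<ge> 2" "(1 + 2 / real L) ^ ?d - (1 - 2 / real L) ^ ?d < \<theta>"
    unfolding eventually_sequentially by blast
  define Q :: "(int ^ 'n) set" where "Q = lattice_box 0 L"
  define outer :: "(int ^ 'n) set" where "outer = lattice_box (-1) (L + 1)"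
  define inner :: "(int ^ 'n) set" where "inner = lattice_box 1 (L - 1)"
  have cards: "real (card Q) = real L ^ ?d" "real (card outer) = (real L + 2) ^ ?d"
    "real (card inner) = (real L - 2) ^ ?d"
    using L(1) by (simp_all add: Q_def outer_def inner_def card_lattice_box nat_diff_distrib
        nat_add_distrib of_nat_diff add.commute)
  have sub: "{m. (m + e \<in> Q) \<noteq> (m \<in> Q)} \<subseteq> outer - inner" if e: "is_bond e 0" for e
  proof (intro subsetI)
    fix m assume m: "m \<in> {m. (m + e \<in> Q) \<noteq> (m \<in> Q)}"
    have e1: "-1 \<le> e $ i" "e $ i \<le> 1" for i using bond_component_le[OF e, of i] by linarith+
    have "m \<in> outer"
    proof -
      have "-1 \<le> m $ i \<and> m $ i < L + 1" if "m \<in> Q \<or> m + e \<in> Q" for i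
        using that e1[of i] by (auto simp: Q_def lattice_box_def dest!: spec[of _ i])
      then show ?thesis using m by (auto simp: outer_def lattice_box_def)
    qed
    moreover have "m \<in> Q \<and> m + e \<in> Q" if "m \<in> inner"
    proof -
      have "0 \<le> m $ i \<and> m $ i < L \<and> 0 \<le> m $ i + e $ i \<and> m $ i + e $ i < L" for i
        using that e1[of i] by (auto simp: inner_def lattice_box_def dest!: spec[of _ i])
      then show ?thesis by (auto simp: Q_def lattice_box_def)
    qed
    ultimately show "m \<in> outer - inner" using m by auto
  qed
  have "real (card (outer - inner)) = (real L + 2) ^ ?d - (real L - 2) ^ ?d"
  proof -
    have "inner \<subseteq> outer" unfolding outer_def inner_def by (rule lattice_box_mono) auto
    then have "card (outer - inner) = card outer - card inner" "card inner \<le> card outer"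
      by (auto simp: outer_def inner_def card_Diff_subset card_mono finite_lattice_box)
    then show ?thesis using cards by (simp add: of_nat_diff)
  qed
  also have "\<dots> = ((1 + 2 / real L) ^ ?d - (1 - 2 / real L) ^ ?d) * real L ^ ?d"
  proof -
    have "(1 + 2 / real L) * real L = real L + 2" "(1 - 2 / real L) * real L = real L - 2"
      using L(1) by (simp_all add: field_simps)
    then show ?thesis
      by (simp only: left_diff_distrib[of "(1 + 2 / real L) ^ ?d"] power_mult_distrib[symmetric])
  qed
  also have "\<dots> \<le> \<theta> * card Q" using L(2) cards(1) by (simp add: mult_right_mono)
  finally have "real (card (outer - inner)) \<le> \<theta> * card Q" .
  moreover have fin: "finite (outer - inner)" by (simp add: outer_def finite_lattice_box)
  ultimately have "card {m. (m + e \<in> Q) \<noteq> (m \<in> Q)} \<le> \<theta> * card Q" if "is_bond e 0" for e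
    using card_mono[OF fin sub[OF that]] by linarith
  moreover have "0 \<in> Q" using L(1) by (simp add: Q_def lattice_box_def)
  ultimately show ?thesis
    using finite_subset[OF sub fin] by (intro that[of Q]) (auto simp: Q_def finite_lattice_box)
qed

section \<open>Jacobi matrices as bounded self-adjoint operators\<close>

lemma lattice_norm_minus [simp]: "lattice_norm (- n) = lattice_norm n"
proof -
  have "(\<chi> i. real_of_int ((- n) $ i)) = - (\<chi> i. real_of_int (n $ i))"
    by (simp add: vec_eq_iff)
  then show ?thesis by (simp add: lattice_norm_def)
qed

lemma is_bond_commute: "is_bond m n \<longleftrightarrow> is_bond n m"
  using lattice_norm_minus[of "m - n"] by (simp add: is_bond_def)

lemma is_bond_add_cancel [simp]: "is_bond (k + m) (k + n) \<longleftrightarrow> is_bond m n"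
  by (simp add: is_bond_def)

lemma is_bond_add_self [simp]: "is_bond (n + e) n \<longleftrightarrow> is_bond e 0"
  by (simp add: is_bond_def)

lemma is_bond_minus [simp]: "is_bond (- e) 0 \<longleftrightarrow> is_bond e 0"
  by (simp add: is_bond_def)

lemma not_is_bond_self [simp]: "\<not> is_bond n n"
  by (simp add: is_bond_def lattice_norm_def zero_vec_def[symmetric])

text \<open>The directions \<open>e\<close> form an index set independent of the site, which turns
  the matrix into a finite sum of shifts followed by multiplications.\<close>

lemma jacobi_eq_directions:
  "jacobi a b u n = (\<Sum>e | is_bond e 0. complex_of_real (a {n, n + e}) * u (n + e))
     + complex_of_real (b n) * u n"
  unfolding jacobi_def
  by (intro arg_cong2[of _ _ _ _ "(+)"] sum.reindex_bij_witness[of _ "\<lambda>e. n + e" "\<lambda>m. m - n"] refl)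
    (auto simp: is_bond_def)

definition jacobi_l2 :: "((int ^ 'n) set \<Rightarrow> real) \<Rightarrow> (int ^ 'n \<Rightarrow> real) \<Rightarrow> (int ^ 'n) l2 \<Rightarrow> (int ^ 'n) l2" where
  "jacobi_l2 a b u = (\<Sum>e | is_bond e 0. l2_mult (\<lambda>n. complex_of_real (a {n, n + e})) (l2_shift e u))
     + l2_mult (\<lambda>n. complex_of_real (b n)) u"

text \<open>The same constant \<open>K\<close> serves all translates and all limit points, which
  makes them instances of this locale as well.\<close>

locale bounded_jacobi =
  fixes a :: "(int ^ 'n) set \<Rightarrow> real" and b :: "int ^ 'n \<Rightarrow> real" and K :: real
  assumes a_bound: "is_bond m n \<Longrightarrow> \<bar>a {n, m}\<bar> \<le> K" and b_bound: "\<bar>b n\<bar> \<le> K"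
begin

lemma bounded_a: "is_bond e 0 \<Longrightarrow> bounded (range (\<lambda>n. complex_of_real (a {n, n + e})))"
  using a_bound by (auto simp: bounded_iff intro!: exI[of _ K])

lemma bounded_b: "bounded (range (\<lambda>n. complex_of_real (b n)))"
  using b_bound by (auto simp: bounded_iff)

lemma l2_fun_jacobi: "l2_fun (jacobi_l2 a b u) n =
    (\<Sum>e | is_bond e 0. complex_of_real (a {n, n + e}) * l2_fun u (n + e)) + complex_of_real (b n) * l2_fun u n"
  by (simp add: jacobi_l2_def bounded_a bounded_b)

text \<open>The terms for \<open>e\<close> and \<open>- e\<close> are adjoint to each other, because
  an unordered pair carries the same coefficient from both ends; \<open>e \<mapsto> - e\<close>
  permutes the directions.\<close>

lemma self_adjoint_jacobi: "self_adjoint (jacobi_l2 a b)"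
  unfolding self_adjoint_def
proof (intro conjI allI)
  show "bounded_linear (jacobi_l2 a b)"
    unfolding jacobi_l2_def
    by (intro bounded_linear_add bounded_linear_sum bounded_linear_l2_mult
        bounded_linear_compose[OF bounded_linear_l2_mult bounded_linear_l2_shift])
  let ?M = "\<lambda>e. l2_mult (\<lambda>n. complex_of_real (a {n, n + e}))"
  fix u v :: "(int ^ 'n) l2"
  have "?M e (l2_shift e u) \<bullet> v = u \<bullet> ?M (- e) (l2_shift (- e) v)" if e: "is_bond e 0" for e
  proof -
    have "l2_shift (- e) (?M e v) = ?M (- e) (l2_shift (- e) v)"
      using bounded_a[OF e] bounded_a[of "- e"] e by (intro l2_eqI) (simp add: insert_commute)
    then show ?thesis
      by (simp add: l2_mult_adjoint[OF bounded_a[OF e]] l2_shift_adjoint)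
  qed
  then have "(\<Sum>e | is_bond e 0. ?M e (l2_shift e u) \<bullet> v)
      = (\<Sum>e | is_bond e 0. u \<bullet> ?M (- e) (l2_shift (- e) v))" by simp
  also have "\<dots> = (\<Sum>e | is_bond e 0. u \<bullet> ?M e (l2_shift e v))"
    by (rule sum.reindex_bij_witness[of _ uminus uminus]) auto
  finally show "jacobi_l2 a b u \<bullet> v = u \<bullet> jacobi_l2 a b v"
    by (simp add: jacobi_l2_def inner_add_left inner_add_right inner_sum_left inner_sum_right
        l2_mult_adjoint[OF bounded_b])
qed

sublocale ell2_self_adjoint "jacobi a b" "jacobi_l2 a b"
proof
  show "jacobi a b (l2_fun u) = l2_fun (jacobi_l2 a b u)" for u
    by (rule ext) (simp add: jacobi_eq_directions l2_fun_jacobi)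
  show "jacobi_l2 a b (l2_scale c u) = l2_scale c (jacobi_l2 a b u)" for c u
    by (rule l2_eqI) (simp add: l2_fun_jacobi sum_distrib_left algebra_simps)
qed (rule self_adjoint_jacobi)

text \<open>Summing over all translates of the box, the commutators of the cutoffs with the operator
  contribute only through the boundary of the box.\<close>

lemma localization:
  fixes x \<eta> :: real
  assumes \<eta>: "\<eta> > 0"
  obtains Q :: "(int ^ 'n) set" where "finite Q"
    "\<And>u. norm (jacobi_l2 a b u - x *\<^sub>R u) < \<eta> / 2 * norm u \<Longrightarrow>
       \<exists>y. let v = l2_mult (\<lambda>n. indicator Q (n - y)) u in norm (jacobi_l2 a b v - x *\<^sub>R v) < \<eta> * norm v"
proof -
  define D where "D = real (card {e :: int ^ 'n. is_bond e 0})"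
  have D0: "D \<ge> 0" by (simp add: D_def)
  \<comment> \<open>Makes the boundary contribution
    \<open>2 * D\<^sup>2 * K\<^sup>2 * \<theta>\<close> at most \<open>\<eta>\<^sup>2 / 2\<close>;
    the summand 1 excludes division by 0.\<close>
  define \<theta> where "\<theta> = \<eta>\<^sup>2 / (4 * (D\<^sup>2 * K\<^sup>2 + 1))"
  have pos: "D\<^sup>2 * K\<^sup>2 + 1 > 0" by (intro add_nonneg_pos) auto
  have \<theta>: "\<theta> > 0" using \<eta> pos by (simp add: \<theta>_def)
  obtain Q :: "(int ^ 'n) set" where Q: "finite Q" "Q \<noteq> {}"
    "\<And>e. is_bond e 0 \<Longrightarrow> finite {m. (m + e \<in> Q) \<noteq> (m \<in> Q)}"
    "\<And>e. is_bond e 0 \<Longrightarrow> card {m. (m + e \<in> Q) \<noteq> (m \<in> Q)} \<le> \<theta> * card Q"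
    using exists_almost_invariant_box[OF \<theta>] by blast
  define R where "R e = {m. (m + e \<in> Q) \<noteq> (m \<in> Q)}" for e
  have "\<exists>y. let v = l2_mult (\<lambda>n. indicator Q (n - y)) u in norm (jacobi_l2 a b v - x *\<^sub>R v) < \<eta> * norm v"
    if u: "norm (jacobi_l2 a b u - x *\<^sub>R u) < \<eta> / 2 * norm u" for u
  proof (rule ccontr)
    assume neg: "\<not> ?thesis"
    have finR: "finite (R e)" if "is_bond e 0" for e using Q(3)[OF that] by (simp add: R_def)
    define P where "P y = l2_mult (\<lambda>n. indicator Q (n - y)) u" for y
    define w where "w = jacobi_l2 a b u - x *\<^sub>R u"
    define U where "U n = (cmod (l2_fun u n))\<^sup>2" for n
    define W where "W n = (cmod (l2_fun w n))\<^sup>2" for n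
    have ge: "\<eta> * norm (P y) \<le> norm (jacobi_l2 a b (P y) - x *\<^sub>R P y)" for y
      using neg by (auto simp: P_def Let_def not_less)
    have bdd: "bounded (range (\<lambda>n. indicator Q (n - y) :: complex))" for y
      by (auto simp: bounded_iff indicator_def intro!: exI[of _ 1])
    have P_fun: "l2_fun (P y) n = indicator Q (n - y) * l2_fun u n" for y n
      by (simp add: P_def bdd)
    have P_norm: "(norm (P y))\<^sup>2 = (\<Sum>q\<in>Q. U (y + q))" for y
    proof -
      have "(\<lambda>n. (cmod (l2_fun (P y) n))\<^sup>2) = (\<lambda>n. indicator Q (n - y) * U n)"
        by (auto simp: P_fun U_def indicator_def)
      then show ?thesis
        unfolding l2_norm_square using has_sum_indicator_translate[OF Q(1), of y U] by (simp add: infsumI)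
    qed
    \<comment> \<open>The diagonal part commutes with the cutoff. \<open>g e\<close> is the
      commutator with the term in direction \<open>e\<close> and vanishes unless
      \<open>n - y\<close> lies in \<open>R e\<close>; the factor \<open>D\<close> comes from
      Cauchy-Schwarz over the directions.\<close>
    have pointwise: "(cmod (l2_fun (jacobi_l2 a b (P y) - x *\<^sub>R P y) n))\<^sup>2 \<le>
        2 * (indicator Q (n - y) * W n) + 2 * D * K\<^sup>2 * (\<Sum>e | is_bond e 0. indicator (R e) (n - y) * U (n + e))"
      for y n
    proof -
      define g where "g e = complex_of_real (a {n, n + e})
          * (indicator Q (n + e - y) - indicator Q (n - y)) * l2_fun u (n + e)"
        for e
      have "l2_fun (jacobi_l2 a b (P y) - x *\<^sub>R P y) n
          = indicator Q (n - y) * l2_fun w n + (\<Sum>e | is_bond e 0. g e)"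
        by (simp add: w_def g_def l2_fun_jacobi P_fun algebra_simps sum_subtractf sum_distrib_left)
      then have "(cmod (l2_fun (jacobi_l2 a b (P y) - x *\<^sub>R P y) n))\<^sup>2
          \<le> (cmod (indicator Q (n - y) * l2_fun w n) + cmod (\<Sum>e | is_bond e 0. g e))\<^sup>2"
        by (simp add: norm_triangle_ineq power_mono)
      also have "\<dots> \<le> 2 * (cmod (indicator Q (n - y) * l2_fun w n))\<^sup>2 + 2 * (cmod (\<Sum>e | is_bond e 0. g e))\<^sup>2"
        using sum_squares_bound[of "cmod (indicator Q (n - y) * l2_fun w n)" "cmod (\<Sum>e | is_bond e 0. g e)"]
        unfolding power2_sum by linarith
      also have "(cmod (indicator Q (n - y) * l2_fun w n))\<^sup>2 = indicator Q (n - y) * W n"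
        by (simp add: W_def indicator_def)
      also have "(cmod (\<Sum>e | is_bond e 0. g e))\<^sup>2 \<le> (\<Sum>e | is_bond e 0. cmod (g e))\<^sup>2"
        by (intro power_mono norm_sum) auto
      also have "\<dots> \<le> (\<Sum>e | is_bond e 0. (cmod (g e))\<^sup>2) * D"
        unfolding D_def by (rule sum_squared_le_sum_of_squares)
      also have "(\<Sum>e | is_bond e 0. (cmod (g e))\<^sup>2)
          \<le> (\<Sum>e | is_bond e 0. K\<^sup>2 * (indicator (R e) (n - y) * U (n + e)))"
      proof (rule sum_mono)
        fix e :: "int ^ 'n" assume "e \<in> {e. is_bond e 0}"
        then have "\<bar>a {n, n + e}\<bar> \<le> K" by (intro a_bound) simp
        then have "\<bar>a {n, n + e}\<bar>\<^sup>2 \<le> K\<^sup>2" by (intro power_mono) auto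
        moreover have "(cmod (indicator Q (n + e - y) - indicator Q (n - y)))\<^sup>2 = indicator (R e) (n - y)"
          by (auto simp: R_def indicator_def algebra_simps)
        moreover have "(cmod (g e))\<^sup>2 = \<bar>a {n, n + e}\<bar>\<^sup>2
            * ((cmod (indicator Q (n + e - y) - indicator Q (n - y)))\<^sup>2 * U (n + e))"
          by (simp add: g_def norm_mult power_mult_distrib U_def)
        ultimately show "(cmod (g e))\<^sup>2 \<le> K\<^sup>2 * (indicator (R e) (n - y) * U (n + e))"
          by (simp add: mult_right_mono U_def)
      qed
      finally show ?thesis
        using D0 by (simp add: mult_right_mono flip: sum_distrib_left) (simp add: mult_ac)
    qed
    have P_bound: "\<eta>\<^sup>2 * (\<Sum>q\<in>Q. U (y + q)) \<le>
        2 * (\<Sum>q\<in>Q. W (y + q)) + 2 * D * K\<^sup>2 * (\<Sum>e | is_bond e 0. \<Sum>q\<in>R e. U (y + q + e))" for y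
    proof -
      have "\<eta>\<^sup>2 * (\<Sum>q\<in>Q. U (y + q)) = (\<eta> * norm (P y))\<^sup>2" by (simp add: P_norm power_mult_distrib)
      also have "\<dots> \<le> (norm (jacobi_l2 a b (P y) - x *\<^sub>R P y))\<^sup>2"
        using ge \<eta> by (intro power_mono) auto
      also have "\<dots> \<le> 2 * (\<Sum>q\<in>Q. W (y + q)) + 2 * D * K\<^sup>2 * (\<Sum>e | is_bond e 0. \<Sum>q\<in>R e. U (y + q + e))"
      proof (rule has_sum_mono[OF _ _ pointwise])
        show "((\<lambda>n. (cmod (l2_fun (jacobi_l2 a b (P y) - x *\<^sub>R P y) n))\<^sup>2) has_sum
            (norm (jacobi_l2 a b (P y) - x *\<^sub>R P y))\<^sup>2) UNIV"
          unfolding l2_norm_square by (rule has_sum_infsum[OF l2_summable])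
        show "((\<lambda>n. 2 * (indicator Q (n - y) * W n)
              + 2 * D * K\<^sup>2 * (\<Sum>e | is_bond e 0. indicator (R e) (n - y) * U (n + e))) has_sum
            2 * (\<Sum>q\<in>Q. W (y + q)) + 2 * D * K\<^sup>2 * (\<Sum>e | is_bond e 0. \<Sum>q\<in>R e. U (y + q + e))) UNIV"
          by (intro has_sum_add has_sum_cmult_right has_sum_sum has_sum_indicator_translate)
            (auto simp: Q(1) finR)
      qed
      finally show ?thesis .
    qed
    have U_sum: "((\<lambda>y. U (y + c)) has_sum (norm u)\<^sup>2) UNIV" for c
    proof -
      have "(U has_sum (norm u)\<^sup>2) UNIV"
        unfolding U_def l2_norm_square by (rule has_sum_infsum[OF l2_summable])
      then show ?thesis using has_sum_reindex_bij_betw[OF bij_plus_right[of c], of U] by simp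
    qed
    have W_sum: "((\<lambda>y. W (y + c)) has_sum (norm w)\<^sup>2) UNIV" for c
    proof -
      have "(W has_sum (norm w)\<^sup>2) UNIV"
        unfolding W_def l2_norm_square by (rule has_sum_infsum[OF l2_summable])
      then show ?thesis using has_sum_reindex_bij_betw[OF bij_plus_right[of c], of W] by simp
    qed
    \<comment> \<open>In the sum over \<open>y\<close>, every element of \<open>Q\<close>
      contributes a full squared norm, and so does every element of \<open>R e\<close>; the
      comparison is thus between \<open>card Q\<close> and the boundary counts.\<close>
    have main: "\<eta>\<^sup>2 * (\<Sum>q\<in>Q. (norm u)\<^sup>2) \<le>
        2 * (\<Sum>q\<in>Q. (norm w)\<^sup>2) + 2 * D * K\<^sup>2 * (\<Sum>e | is_bond e 0. \<Sum>q\<in>R e. (norm u)\<^sup>2)"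
    proof (rule has_sum_mono[OF _ _ P_bound])
      show "((\<lambda>y. \<eta>\<^sup>2 * (\<Sum>q\<in>Q. U (y + q))) has_sum \<eta>\<^sup>2 * (\<Sum>q\<in>Q. (norm u)\<^sup>2)) UNIV"
        by (intro has_sum_cmult_right has_sum_sum U_sum)
      show "((\<lambda>y. 2 * (\<Sum>q\<in>Q. W (y + q)) + 2 * D * K\<^sup>2 * (\<Sum>e | is_bond e 0. \<Sum>q\<in>R e. U (y + q + e)))
          has_sum 2 * (\<Sum>q\<in>Q. (norm w)\<^sup>2) + 2 * D * K\<^sup>2 * (\<Sum>e | is_bond e 0. \<Sum>q\<in>R e. (norm u)\<^sup>2)) UNIV"
        unfolding add.assoc by (intro has_sum_add has_sum_cmult_right has_sum_sum U_sum W_sum)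
    qed
    have "(\<Sum>e | is_bond e 0. \<Sum>q\<in>R e. (norm u)\<^sup>2) \<le> (\<Sum>e :: int ^ 'n | is_bond e 0. \<theta> * card Q * (norm u)\<^sup>2)"
    proof (rule sum_mono)
      fix e :: "int ^ 'n" assume "e \<in> {e. is_bond e 0}"
      then have "real (card (R e)) \<le> \<theta> * card Q" using Q(4) by (simp add: R_def)
      then show "(\<Sum>q\<in>R e. (norm u)\<^sup>2) \<le> \<theta> * card Q * (norm u)\<^sup>2" by (simp add: mult_right_mono)
    qed
    also have "\<dots> = D * (\<theta> * card Q * (norm u)\<^sup>2)" by (simp add: D_def)
    finally have "2 * D * K\<^sup>2 * (\<Sum>e | is_bond e 0. \<Sum>q\<in>R e. (norm u)\<^sup>2)
        \<le> 2 * D * K\<^sup>2 * (D * (\<theta> * card Q * (norm u)\<^sup>2))"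
      using D0 by (intro mult_left_mono) auto
    with main have "card Q * (\<eta>\<^sup>2 * (norm u)\<^sup>2)
        \<le> card Q * (2 * (norm w)\<^sup>2 + 2 * (D\<^sup>2 * K\<^sup>2 * \<theta>) * (norm u)\<^sup>2)"
      by (simp add: algebra_simps power2_eq_square)
    then have "\<eta>\<^sup>2 * (norm u)\<^sup>2 \<le> 2 * (norm w)\<^sup>2 + 2 * (D\<^sup>2 * K\<^sup>2 * \<theta>) * (norm u)\<^sup>2"
      using Q(1,2) by (simp add: card_gt_0_iff)
    moreover have "D\<^sup>2 * K\<^sup>2 * \<theta> \<le> \<eta>\<^sup>2 / 4"
    proof -
      have "D\<^sup>2 * K\<^sup>2 * \<theta> \<le> (D\<^sup>2 * K\<^sup>2 + 1) * \<theta>" using \<theta> by (simp add: algebra_simps)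
      also have "\<dots> = \<eta>\<^sup>2 / 4"
      proof -
        have "c * (\<eta>\<^sup>2 / (4 * c)) = \<eta>\<^sup>2 / 4" if "c > 0" for c using that by simp
        from this[OF pos] show ?thesis unfolding \<theta>_def .
      qed
      finally show ?thesis .
    qed
    then have "2 * (D\<^sup>2 * K\<^sup>2 * \<theta>) * (norm u)\<^sup>2 \<le> 2 * (\<eta>\<^sup>2 / 4) * (norm u)\<^sup>2"
      by (intro mult_right_mono) auto
    \<comment> \<open>The factor 1/2 in the assumption on \<open>u\<close> makes
      \<open>2 * (norm w)\<^sup>2\<close> less than half of
      \<open>(\<eta> * norm u)\<^sup>2\<close>; the boundary takes at most the other half.\<close>
    moreover have "(norm w)\<^sup>2 < (\<eta> / 2 * norm u)\<^sup>2"
      using u by (intro power_strict_mono) (auto simp: w_def)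
    ultimately show False by (simp add: power_mult_distrib power_divide)
  qed
  then show ?thesis using Q(1) that by blast
qed

end

section \<open>Limit points at infinity\<close>

lemma bounded_jacobi_translate:
  assumes "bounded_jacobi a b K"
  shows "bounded_jacobi (\<lambda>S. a ((+) x ` S)) (\<lambda>n. b (x + n)) K"
  using assms by (simp add: bounded_jacobi_def)

text \<open>Translating the coefficients amounts to conjugation with a norm-preserving shift, so
  approximate eigenvectors move between far sites and the origin without a change of any
  norm.\<close>

lemma jacobi_l2_translate:
  assumes "bounded_jacobi a b K"
  shows "jacobi_l2 (\<lambda>S. a ((+) x ` S)) (\<lambda>n. b (x + n)) (l2_shift x u) = l2_shift x (jacobi_l2 a b u)"
  by (rule l2_eqI)
    (simp add: bounded_jacobi.l2_fun_jacobi[OF assms]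
      bounded_jacobi.l2_fun_jacobi[OF bounded_jacobi_translate[OF assms]], simp add: ac_simps)

text \<open>Separated from the divergence of \<open>x\<close>, because compactness supplies only
  this condition; divergence is inherited by subsequences.\<close>

definition coeffs_converge ::
    "((int ^ 'n) set \<Rightarrow> real) \<Rightarrow> (int ^ 'n \<Rightarrow> real) \<Rightarrow> (nat \<Rightarrow> int ^ 'n) \<Rightarrow>
     ((int ^ 'n) set \<Rightarrow> real) \<Rightarrow> (int ^ 'n \<Rightarrow> real) \<Rightarrow> bool" where
  "coeffs_converge a b x a' b' \<longleftrightarrow>
     (\<forall>l. (\<lambda>j. b (x j + l)) \<longlonglongrightarrow> b' l) \<and>
     (\<forall>k l. is_bond k l \<longrightarrow> (\<lambda>j. a {x j + l, x j + k}) \<longlonglongrightarrow> a' {k, l})"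

lemma limit_points_at_infinity_altdef:
  "limit_points_at_infinity a b =
     {jacobi a' b' | a' b'.
        \<exists>x. filterlim (\<lambda>j. lattice_norm (x j)) at_top sequentially \<and> coeffs_converge a b x a' b'}"
  by (simp add: limit_points_at_infinity_def coeffs_converge_def)

lemma bounded_jacobi_limit:
  fixes a :: "(int ^ 'n) set \<Rightarrow> real"
  assumes J: "bounded_jacobi a b K" and conv: "coeffs_converge a b x a' b'"
  shows "bounded_jacobi a' b' K"
proof
  fix m n :: "int ^ 'n"
  show "\<bar>a' {n, m}\<bar> \<le> K" if bond: "is_bond m n"
  proof (rule tendsto_upperbound)
    show "(\<lambda>j. \<bar>a {x j + m, x j + n}\<bar>) \<longlonglongrightarrow> \<bar>a' {n, m}\<bar>"
      using conv bond is_bond_commute[of m n] by (intro tendsto_rabs) (auto simp: coeffs_converge_def)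
    show "\<forall>\<^sub>F j in sequentially. \<bar>a {x j + m, x j + n}\<bar> \<le> K"
      using bond is_bond_commute[of m n] by (intro always_eventually allI bounded_jacobi.a_bound[OF J]) simp
  qed simp
  show "\<bar>b' n\<bar> \<le> K"
  proof (rule tendsto_upperbound)
    show "(\<lambda>j. \<bar>b (x j + n)\<bar>) \<longlonglongrightarrow> \<bar>b' n\<bar>"
      using conv by (intro tendsto_rabs) (auto simp: coeffs_converge_def)
    show "\<forall>\<^sub>F j in sequentially. \<bar>b (x j + n)\<bar> \<le> K"
      by (intro always_eventually allI bounded_jacobi.b_bound[OF J])
  qed simp
qed

text \<open>All images are supported in \<open>Q'\<close>, the set \<open>Q\<close> with its
  neighbours, so the norms are finite sums and coordinatewise convergence is enough. Varying
  \<open>v\<close> is needed for limits of approximate eigenvectors, constant \<open>v\<close> for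
  transplanting a vector from a limit point.\<close>

lemma jacobi_l2_norm_converge:
  assumes J: "bounded_jacobi a b K" and conv: "coeffs_converge a b x a' b'" and Q: "finite Q"
    and v: "\<And>n. (\<lambda>j. l2_fun (v j) n) \<longlonglongrightarrow> l2_fun w n"
    and v0: "\<And>j n. n \<notin> Q \<Longrightarrow> l2_fun (v j) n = 0"
  shows "(\<lambda>j. norm (jacobi_l2 (\<lambda>S. a ((+) (x j) ` S)) (\<lambda>n. b (x j + n)) (v j) - E *\<^sub>R v j))
      \<longlonglongrightarrow> norm (jacobi_l2 a' b' w - E *\<^sub>R w)"
proof -
  define Q' where "Q' = Q \<union> (\<Union>q\<in>Q. \<Union>e\<in>{e. is_bond e 0}. {q - e})"
  have finQ': "finite Q'" using Q by (auto simp: Q'_def finite_bonds)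
  have Q': "n \<notin> Q" "is_bond e 0 \<Longrightarrow> n + e \<notin> Q" if "n \<notin> Q'" for n e
    using that by (auto simp: Q'_def) (metis add_diff_cancel_right')
  have w0: "l2_fun w n = 0" if "n \<notin> Q" for n
    using v[of n] v0[OF that] by (simp add: LIMSEQ_const_iff)
  let ?f = "\<lambda>j. jacobi_l2 (\<lambda>S. a ((+) (x j) ` S)) (\<lambda>n. b (x j + n)) (v j) - E *\<^sub>R v j"
  let ?g = "jacobi_l2 a' b' w - E *\<^sub>R w"
  have f: "l2_fun (?f j) n = (\<Sum>e | is_bond e 0. complex_of_real (a {x j + n, x j + (n + e)}) * l2_fun (v j) (n + e))
      + complex_of_real (b (x j + n)) * l2_fun (v j) n - complex_of_real E * l2_fun (v j) n" for j n
    by (simp add: bounded_jacobi.l2_fun_jacobi[OF bounded_jacobi_translate[OF J]])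
  have g: "l2_fun ?g n = (\<Sum>e | is_bond e 0. complex_of_real (a' {n, n + e}) * l2_fun w (n + e))
      + complex_of_real (b' n) * l2_fun w n - complex_of_real E * l2_fun w n" for n
    by (simp add: bounded_jacobi.l2_fun_jacobi[OF bounded_jacobi_limit[OF J conv]])
  have a_lim: "(\<lambda>j. a {x j + n, x j + (n + e)}) \<longlonglongrightarrow> a' {n, n + e}" if "is_bond e 0" for e n
  proof -
    have "(\<lambda>j. a {x j + n, x j + (n + e)}) \<longlonglongrightarrow> a' {n + e, n}"
      using conv that by (simp add: coeffs_converge_def)
    then show ?thesis by (simp add: insert_commute)
  qed
  have b_lim: "(\<lambda>j. b (x j + n)) \<longlonglongrightarrow> b' n" for n
    using conv by (simp add: coeffs_converge_def)
  have coord: "(\<lambda>j. l2_fun (?f j) n) \<longlonglongrightarrow> l2_fun ?g n" for n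
    unfolding f g by (intro tendsto_intros v b_lim a_lim) auto
  have f0: "l2_fun (?f j) n = 0" if "n \<notin> Q'" for j n
    unfolding f using Q'[OF that] by (simp add: v0)
  have g0: "l2_fun ?g n = 0" if "n \<notin> Q'" for n
    unfolding g using Q'[OF that] by (simp add: w0)
  have "(\<lambda>j. (norm (?f j))\<^sup>2) \<longlonglongrightarrow> (norm ?g)\<^sup>2"
  proof -
    have "(norm (?f j))\<^sup>2 = (\<Sum>n\<in>Q'. (cmod (l2_fun (?f j) n))\<^sup>2)" for j
      by (rule l2_norm_finite_support[OF finQ' f0])
    moreover have "(norm ?g)\<^sup>2 = (\<Sum>n\<in>Q'. (cmod (l2_fun ?g n))\<^sup>2)"
      by (rule l2_norm_finite_support[OF finQ' g0])
    moreover have "(\<lambda>j. \<Sum>n\<in>Q'. (cmod (l2_fun (?f j) n))\<^sup>2) \<longlonglongrightarrow> (\<Sum>n\<in>Q'. (cmod (l2_fun ?g n))\<^sup>2)"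
      by (intro tendsto_sum tendsto_power tendsto_norm coord)
    ultimately show ?thesis by (simp only:)
  qed
  from tendsto_real_sqrt[OF this] show ?thesis by (simp only: real_sqrt_abs abs_norm_cancel)
qed

text \<open>Both families of coefficients are packed into one family over ordered pairs, so that one
  extraction serves both; \<open>(l, l)\<close> is never a bond and therefore carries
  \<open>b\<close>.\<close>

lemma coeffs_converge_subseq:
  fixes x :: "nat \<Rightarrow> int ^ 'n"
  assumes J: "bounded_jacobi a b K"
  obtains r a' b' where "strict_mono r" "coeffs_converge a b (x \<circ> r) a' b'"
proof -
  define f where "f j kl = (case kl of (k, l) \<Rightarrow> if is_bond k l then a {x j + l, x j + k} else b (x j + l))"
    for j and kl :: "(int ^ 'n) \<times> (int ^ 'n)"
  have "\<bar>f j kl\<bar> \<le> K" for j kl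
    using bounded_jacobi.a_bound[OF J] bounded_jacobi.b_bound[OF J] by (auto simp: f_def split: prod.splits)
  then have "bounded (range (\<lambda>j. f j kl))" for kl
    unfolding bounded_iff by (intro exI[of _ K]) (simp del: split_paired_All)
  then obtain r c where r: "strict_mono r" "\<And>kl. (\<lambda>j. f (r j) kl) \<longlonglongrightarrow> c kl"
    using bounded_pointwise_convergent_subseq[of f] by blast
  \<comment> \<open>The limits \<open>c\<close> depend on ordered pairs. Taking \<open>lim\<close>
    over images of the set \<open>S\<close> gives a function of unordered pairs; its values on sets
    without convergence are arbitrary.\<close>
  define a' where "a' S = lim (\<lambda>j. a ((+) (x (r j)) ` S))" for S
  have "(\<lambda>j. a {x (r j) + l, x (r j) + k}) \<longlonglongrightarrow> a' {k, l}" if "is_bond k l" for k l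
  proof -
    have "(\<lambda>j. a ((+) (x (r j)) ` {k, l})) \<longlonglongrightarrow> c (k, l)"
      using r(2)[of "(k, l)"] that by (simp add: f_def insert_commute)
    then show ?thesis unfolding a'_def by (simp add: limI insert_commute)
  qed
  moreover have "(\<lambda>j. b (x (r j) + l)) \<longlonglongrightarrow> c (l, l)" for l
    using r(2)[of "(l, l)"] by (simp add: f_def)
  ultimately show ?thesis
    using r(1) by (intro that[of r a' "\<lambda>l. c (l, l)"]) (auto simp: coeffs_converge_def)
qed

section \<open>The two inclusions\<close>

context bounded_jacobi
begin

text \<open>The tolerance is shared between the residual at a spectral point \<open>w\<close> of a
  limit point and the distance from \<open>w\<close> to \<open>z\<close>, so points of the closure
  are treated together with points of the union.\<close>

lemma essential_spectrum_supset:
  assumes z: "z \<in> closure (\<Union>J \<in> limit_points_at_infinity a b. ell2_spectrum J)"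
  shows "z \<in> ell2_essential_spectrum (jacobi a b)"
  unfolding essential_spectrum_iff
proof
  have J: "bounded_jacobi a b K" by unfold_locales
  have real: "Im w = 0" if L: "L \<in> limit_points_at_infinity a b" "w \<in> ell2_spectrum L" for L w
  proof -
    obtain a' b' x where "L = jacobi a' b'" "coeffs_converge a b x a' b'"
      using L(1) by (auto simp: limit_points_at_infinity_altdef)
    then interpret lim: bounded_jacobi a' b' K using bounded_jacobi_limit[OF J] by blast
    show ?thesis using L(2) by (simp add: \<open>L = _\<close> lim.ell2_spectrum_iff)
  qed
  have "closure (\<Union>J \<in> limit_points_at_infinity a b. ell2_spectrum J) \<subseteq> {w. Im w = 0}"
    using real by (intro closure_minimal closed_Collect_eq continuous_intros) auto
  then show "Im z = 0" using z by auto
  show "weyl_at_infinity (jacobi_l2 a b) (Re z)"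
    unfolding weyl_at_infinity_def
  proof (intro allI impI)
    fix e :: real and F :: "(int ^ 'n) set" assume e: "e > 0" and F: "finite F"
    obtain L w where L: "L \<in> limit_points_at_infinity a b" "w \<in> ell2_spectrum L" "dist w z < e / 2"
      using z e unfolding closure_approachable by (metis UN_E half_gt_zero)
    obtain a' b' x where L_eq: "L = jacobi a' b'" and x: "filterlim (\<lambda>j. lattice_norm (x j)) at_top sequentially"
      and conv: "coeffs_converge a b x a' b'"
      using L(1) by (auto simp: limit_points_at_infinity_altdef)
    interpret lim: bounded_jacobi a' b' K using bounded_jacobi_limit[OF J conv] .
    let ?T = "jacobi_l2 a' b'"
    have "\<not> bounded_below (\<lambda>u. ?T u - Re w *\<^sub>R u)"
      using L(2) by (simp add: L_eq lim.ell2_spectrum_iff)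
    from not_bounded_belowE[OF this half_gt_zero[OF e]]
    obtain u where u: "norm (?T u - Re w *\<^sub>R u) < e / 2 * norm u" .
    have "bounded_linear (\<lambda>u. ?T u - Re w *\<^sub>R u)"
      using self_adjointD(1)[OF self_adjoint_shift[OF lim.self_adjoint_jacobi]] .
    from l2_truncate_almost_null[OF this u half_gt_zero[OF e]]
    obtain G where G: "finite G" and less: "norm (?T (l2_mult (indicator G) u) - Re w *\<^sub>R l2_mult (indicator G) u)
        < e / 2 * norm (l2_mult (indicator G) u)" .
    define v where "v = l2_mult (indicator G) u"
    have v0: "l2_fun v n = 0" if "n \<notin> G" for n using that by (simp add: v_def bounded_range_indicator)
    have "?T v - Re z *\<^sub>R v = (?T v - Re w *\<^sub>R v) + (Re w - Re z) *\<^sub>R v"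
      by (simp add: algebra_simps)
    then have "norm (?T v - Re z *\<^sub>R v) \<le> norm (?T v - Re w *\<^sub>R v) + \<bar>Re w - Re z\<bar> * norm v"
      by (metis norm_scaleR norm_triangle_ineq)
    also have "\<dots> \<le> norm (?T v - Re w *\<^sub>R v) + e / 2 * norm v"
    proof -
      have "\<bar>Re w - Re z\<bar> \<le> e / 2" using L(3) abs_Re_le_cmod[of "w - z"] by (simp add: dist_norm)
      from mult_right_mono[OF this norm_ge_zero] show ?thesis by simp
    qed
    also have "\<dots> < e * norm v" using less by (simp add: v_def)
    finally have v_less: "norm (?T v - Re z *\<^sub>R v) < e * norm v" .
    have "(\<lambda>j. norm (jacobi_l2 (\<lambda>S. a ((+) (x j) ` S)) (\<lambda>n. b (x j + n)) v - Re z *\<^sub>R v))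
        \<longlonglongrightarrow> norm (?T v - Re z *\<^sub>R v)"
      by (rule jacobi_l2_norm_converge[OF J conv G]) (auto simp: v0)
    from order_tendstoD(2)[OF this v_less]
    have ev1: "\<forall>\<^sub>F j in sequentially.
        norm (jacobi_l2 (\<lambda>S. a ((+) (x j) ` S)) (\<lambda>n. b (x j + n)) v - Re z *\<^sub>R v) < e * norm v" .
    \<comment> \<open>The translate of \<open>G\<close> by \<open>x j\<close> meets \<open>F\<close>
      only if \<open>x j\<close> is one of these finitely many differences, which is impossible for
      large \<open>j\<close>.\<close>
    define H where "H = (\<lambda>(f, g). f - g) ` (F \<times> G)"
    have "\<forall>\<^sub>F j in sequentially. lattice_norm (x j) > Max (insert 0 (lattice_norm ` H))"
      using x by (simp add: filterlim_at_top_dense)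
    then have ev2: "\<forall>\<^sub>F j in sequentially. x j \<notin> H"
    proof eventually_elim
      case (elim j)
      have "finite H" using F G by (simp add: H_def)
      then have "lattice_norm h \<le> Max (insert 0 (lattice_norm ` H))" if "h \<in> H" for h
        using that by (intro Max_ge) auto
      then show ?case using elim by force
    qed
    obtain j where j: "norm (jacobi_l2 (\<lambda>S. a ((+) (x j) ` S)) (\<lambda>n. b (x j + n)) v - Re z *\<^sub>R v) < e * norm v"
      "x j \<notin> H"
      using eventually_happens[OF eventually_conj[OF ev1 ev2]] by auto
    define v' where "v' = l2_shift (- x j) v"
    have v_eq: "v = l2_shift (x j) v'" by (rule l2_eqI) (simp add: v'_def)
    have "l2_fun v' n = 0" if "n \<in> F" for n
    proof -
      have "n - x j \<notin> G"
      proof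
        assume "n - x j \<in> G"
        then have "n - (n - x j) \<in> H" using that unfolding H_def by blast
        then show False using j(2) by simp
      qed
      then show ?thesis by (simp add: v'_def v0)
    qed
    moreover have "norm (jacobi_l2 a b v' - Re z *\<^sub>R v') < e * norm v'"
    proof -
      have "l2_shift (x j) (jacobi_l2 a b v') - Re z *\<^sub>R l2_shift (x j) v'
          = l2_shift (x j) (jacobi_l2 a b v' - Re z *\<^sub>R v')"
        by (rule l2_eqI) simp
      then show ?thesis
        using j(1) unfolding v_eq jacobi_l2_translate[OF J] by simp
    qed
    ultimately show "\<exists>v. (\<forall>n\<in>F. l2_fun v n = 0) \<and> norm (jacobi_l2 a b v - Re z *\<^sub>R v) < e * norm v" by blast
  qed
qed

text \<open>\<open>Q\<close> depends on \<open>\<eta>\<close> but not on \<open>j\<close>: after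
  translation to the origin all vectors are supported in this one finite set.\<close>

lemma far_localized_approx_eigenvectors:
  assumes W: "weyl_at_infinity (jacobi_l2 a b) E" and \<eta>: "\<eta> > 0"
  obtains Q y v where "finite Q" "filterlim (\<lambda>j. lattice_norm (y j)) at_top sequentially"
    "\<And>j n. n \<notin> Q \<Longrightarrow> l2_fun (v j) n = 0" "\<And>j. norm (v j) = 1"
    "\<And>j. norm (jacobi_l2 (\<lambda>S. a ((+) (y j) ` S)) (\<lambda>n. b (y j + n)) (v j) - E *\<^sub>R v j) < \<eta>"
proof -
  have J: "bounded_jacobi a b K" by unfold_locales
  obtain Q :: "(int ^ 'n) set" where Q: "finite Q" and loc:
    "\<And>u. norm (jacobi_l2 a b u - E *\<^sub>R u) < \<eta> / 2 * norm u \<Longrightarrow>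
       \<exists>y. let v = l2_mult (\<lambda>n. indicator Q (n - y)) u in norm (jacobi_l2 a b v - E *\<^sub>R v) < \<eta> * norm v"
    using localization[OF \<eta>, of E] by blast
  have "\<exists>y v. lattice_norm y \<ge> real j \<and> (\<forall>n. n \<notin> Q \<longrightarrow> l2_fun v n = 0) \<and> norm v = 1 \<and>
      norm (jacobi_l2 (\<lambda>S. a ((+) y ` S)) (\<lambda>n. b (y + n)) v - E *\<^sub>R v) < \<eta>" for j
  proof -
    \<comment> \<open>A box at \<open>y\<close> with \<open>lattice_norm y \<le> j\<close> lies
      inside \<open>F\<close>, where \<open>u\<close> vanishes; since the cutoff of \<open>u\<close>
      is nonzero, its box must be far out.\<close>
    define F where "F = (\<Union>q\<in>Q. (\<lambda>n. n + q) ` {n. lattice_norm n \<le> real j})"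
    have "finite F" using Q by (simp add: F_def finite_lattice_norm_le)
    then obtain u where u: "\<And>n. n \<in> F \<Longrightarrow> l2_fun u n = 0" "norm (jacobi_l2 a b u - E *\<^sub>R u) < \<eta> / 2 * norm u"
      using W half_gt_zero[OF \<eta>] unfolding weyl_at_infinity_def by blast
    obtain y where y: "norm (jacobi_l2 a b (l2_mult (\<lambda>n. indicator Q (n - y)) u)
        - E *\<^sub>R l2_mult (\<lambda>n. indicator Q (n - y)) u) < \<eta> * norm (l2_mult (\<lambda>n. indicator Q (n - y)) u)"
      using loc[OF u(2)] unfolding Let_def by blast
    define v where "v = l2_mult (\<lambda>n. indicator Q (n - y)) u"
    have v: "norm (jacobi_l2 a b v - E *\<^sub>R v) < \<eta> * norm v" using y by (simp add: v_def)
    have bdd: "bounded (range (\<lambda>n. indicator Q (n - y) :: complex))"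
      by (auto simp: bounded_iff indicator_def intro!: exI[of _ 1])
    have v_fun: "l2_fun v n = indicator Q (n - y) * l2_fun u n" for n
      by (simp add: v_def bdd)
    have "v \<noteq> 0" using v by auto
    then obtain n where n: "l2_fun v n \<noteq> 0" using l2_eqI[of v 0] by auto
    then have "n - y \<in> Q" "n \<notin> F" using u(1) by (auto simp: v_fun indicator_def split: if_splits)
    then have y_far: "\<not> lattice_norm y \<le> real j"
      unfolding F_def by (auto dest!: bspec[of _ _ "n - y"]) 
    let ?A = "jacobi_l2 (\<lambda>S. a ((+) y ` S)) (\<lambda>n. b (y + n))"
    interpret tr: bounded_jacobi "\<lambda>S. a ((+) y ` S)" "\<lambda>n. b (y + n)" K by (rule bounded_jacobi_translate[OF J])
    have "?A (l2_shift y v) - E *\<^sub>R l2_shift y v = l2_shift y (jacobi_l2 a b v - E *\<^sub>R v)"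
      unfolding jacobi_l2_translate[OF J] by (rule l2_eqI) simp
    then have "norm (?A (l2_shift y v) - E *\<^sub>R l2_shift y v) < \<eta> * norm (l2_shift y v)"
      using v by simp
    from norm_normalized_less[OF self_adjointD(1)[OF self_adjoint_shift[OF tr.self_adjoint_jacobi]] this]
    show ?thesis using y_far
      by (intro exI[of _ y] exI[of _ "inverse (norm (l2_shift y v)) *\<^sub>R l2_shift y v"])
        (auto simp: v_fun indicator_def)
  qed
  then obtain y v where yv: "\<And>j. lattice_norm (y j) \<ge> real j" "\<And>j n. n \<notin> Q \<Longrightarrow> l2_fun (v j) n = 0"
    "\<And>j. norm (v j) = 1"
    "\<And>j. norm (jacobi_l2 (\<lambda>S. a ((+) (y j) ` S)) (\<lambda>n. b (y j + n)) (v j) - E *\<^sub>R v j) < \<eta>"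
    by metis
  moreover have "filterlim (\<lambda>j. lattice_norm (y j)) at_top sequentially"
    by (rule filterlim_at_top_mono[OF filterlim_real_sequentially]) (use yv(1) in auto)
  ultimately show ?thesis using that Q by blast
qed

text \<open>One extraction makes the localized vectors converge, a second one the coefficients
  around them. The residuals stay below \<open>e / 2\<close> because the limit retains only a
  non-strict bound, while \<open>self_adjoint_approx_eigenvalue\<close> needs a strict one by
  \<open>e\<close> to give a spectral point of the limit within \<open>e\<close>.\<close>

lemma essential_spectrum_subset:
  assumes z: "z \<in> ell2_essential_spectrum (jacobi a b)"
  shows "z \<in> closure (\<Union>J \<in> limit_points_at_infinity a b. ell2_spectrum J)"
  unfolding closure_approachable
proof (intro allI impI)
  have J: "bounded_jacobi a b K" by unfold_locales
  define E where "E = Re z"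
  have W: "weyl_at_infinity (jacobi_l2 a b) E" and z_eq: "z = complex_of_real E"
    using z by (auto simp: essential_spectrum_iff E_def complex_eq_iff)
  fix e :: real assume e: "e > 0"
  obtain Q y v where Q: "finite Q" and y: "filterlim (\<lambda>j. lattice_norm (y j)) at_top sequentially"
    and v0: "\<And>j n. n \<notin> Q \<Longrightarrow> l2_fun (v j) n = 0" and v1: "\<And>j. norm (v j) = 1"
    and v: "\<And>j. norm (jacobi_l2 (\<lambda>S. a ((+) (y j) ` S)) (\<lambda>n. b (y j + n)) (v j) - E *\<^sub>R v j) < e / 2"
    using far_localized_approx_eigenvectors[OF W half_gt_zero[OF e]] by blast
  have "bounded (range (\<lambda>j. l2_fun (v j) n))" for n
    using l2_coord_le_norm[of "v _" n] v1 by (auto simp: bounded_iff)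
  then obtain r g where r: "strict_mono r" "\<And>n. (\<lambda>j. l2_fun (v (r j)) n) \<longlonglongrightarrow> g n"
    using bounded_pointwise_convergent_subseq[of "\<lambda>j. l2_fun (v j)"] by blast
  obtain s a' b' where s: "strict_mono s" "coeffs_converge a b ((y \<circ> r) \<circ> s) a' b'"
    using coeffs_converge_subseq[OF J] by blast
  define x where "x = y \<circ> r \<circ> s"
  have conv: "coeffs_converge a b x a' b'" using s(2) by (simp add: x_def)
  have x_lim: "filterlim (\<lambda>j. lattice_norm (x j)) at_top sequentially"
    using filterlim_compose[OF y filterlim_subseq[OF strict_mono_o[OF r(1) s(1)]]] by (simp add: x_def o_def)
  have g_lim: "(\<lambda>j. l2_fun (v (r (s j))) n) \<longlonglongrightarrow> g n" for n
    using LIMSEQ_subseq_LIMSEQ[OF r(2) s(1)] by (simp add: o_def)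
  have g0: "g n = 0" if "n \<notin> Q" for n
    using g_lim[of n] v0[OF that] by (simp add: LIMSEQ_const_iff)
  have "(\<lambda>n. (cmod (g n))\<^sup>2) summable_on UNIV"
    using summable_on_finite[OF Q] summable_on_cong_neutral[of UNIV Q "\<lambda>n. (cmod (g n))\<^sup>2" "\<lambda>n. (cmod (g n))\<^sup>2"] g0
    by auto
  then obtain w where w: "l2_fun w = g" using l2_fun_cases[of g] by (auto simp: ell2_def)
  have "(\<lambda>j. \<Sum>n\<in>Q. (cmod (l2_fun (v (r (s j))) n))\<^sup>2) \<longlonglongrightarrow> (\<Sum>n\<in>Q. (cmod (g n))\<^sup>2)"
    by (intro tendsto_intros g_lim)
  moreover have "(\<Sum>n\<in>Q. (cmod (l2_fun (v j) n))\<^sup>2) = 1" for j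
    using l2_norm_finite_support[OF Q v0, of j] v1 by simp
  ultimately have "(\<Sum>n\<in>Q. (cmod (g n))\<^sup>2) = 1" by (simp add: LIMSEQ_const_iff)
  then have w1: "norm w = 1"
    using l2_norm_finite_support[OF Q, of w] g0 by (simp add: w power2_eq_1_iff) (smt (verit) norm_ge_zero)
  interpret lim: bounded_jacobi a' b' K by (rule bounded_jacobi_limit[OF J conv])
  let ?T = "jacobi_l2 a' b'"
  have "(\<lambda>j. norm (jacobi_l2 (\<lambda>S. a ((+) (x j) ` S)) (\<lambda>n. b (x j + n)) (v (r (s j))) - E *\<^sub>R v (r (s j))))
      \<longlonglongrightarrow> norm (?T w - E *\<^sub>R w)"
    by (rule jacobi_l2_norm_converge[OF J conv Q]) (auto simp: w g_lim v0)
  moreover have "norm (jacobi_l2 (\<lambda>S. a ((+) (x j) ` S)) (\<lambda>n. b (x j + n)) (v (r (s j)))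
       - E *\<^sub>R v (r (s j))) \<le> e / 2" for j
    unfolding x_def o_apply by (rule less_imp_le[OF v])
  ultimately have "norm (?T w - E *\<^sub>R w) \<le> e / 2"
    by (intro tendsto_upperbound[OF _ always_eventually]) auto
  then have "norm (?T w - E *\<^sub>R w) < e * norm w" using w1 e by simp
  from self_adjoint_approx_eigenvalue[OF self_adjoint_shift[OF lim.self_adjoint_jacobi] this]
  obtain d where d: "\<bar>d\<bar> < e" "\<not> bounded_below (\<lambda>u. ?T u - E *\<^sub>R u - d *\<^sub>R u)"
    .
  have "complex_of_real (E + d) \<in> ell2_spectrum (jacobi a' b')"
    using d(2) by (simp only: lim.spectrum_of_real_iff) (simp add: algebra_simps)
  moreover have "jacobi a' b' \<in> limit_points_at_infinity a b"
    using x_lim conv by (auto simp: limit_points_at_infinity_altdef)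
  moreover have "dist (complex_of_real (E + d)) z < e"
    using d(1) by (simp add: z_eq dist_norm)
  ultimately show "\<exists>w\<in>\<Union>J \<in> limit_points_at_infinity a b. ell2_spectrum J. dist w z < e" by blast
qed

end

theorem theorem3p5:
  fixes a :: "(int ^ 'n) set \<Rightarrow> real" and b :: "int ^ 'n \<Rightarrow> real"
  assumes "\<And>m n. is_bond m n \<Longrightarrow> a {n, m} \<noteq> 0"
    and "bdd_above {\<bar>a {n, m}\<bar> + inverse \<bar>a {n, m}\<bar> | m n. is_bond m n}"
    and "bdd_above (range (\<lambda>n. \<bar>b n\<bar>))"
  shows "ell2_essential_spectrum (jacobi a b) =
    closure (\<Union>J \<in> limit_points_at_infinity a b. ell2_spectrum J)"
proof -
  obtain A where A: "\<And>m n. is_bond m n \<Longrightarrow> \<bar>a {n, m}\<bar> + inverse \<bar>a {n, m}\<bar> \<le> A"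
    using assms(2) unfolding bdd_above_def by blast
  obtain B where B: "\<And>n. \<bar>b n\<bar> \<le> B" using assms(3) unfolding bdd_above_def by blast
  interpret bounded_jacobi a b "max A B"
  proof
    show "\<bar>a {n, m}\<bar> \<le> max A B" if "is_bond m n" for m n
    proof -
      have "0 \<le> inverse \<bar>a {n, m}\<bar>" by simp
      with A[OF that] show ?thesis by linarith
    qed
    show "\<bar>b n\<bar> \<le> max A B" for n using B[of n] by simp
  qed
  show ?thesis using essential_spectrum_subset essential_spectrum_supset by blast
qed

end
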